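(* Let $d\ge 5$. There is a constant $C>0$, depending only on $d$, such that the following holds for every positive integer $N$. Let $b$ be a point in $T=T_N^d$ and let $e$ be a random point, uniformly distributed in $T$. Let $R$ be a random walk on $T$ starting from $b$ and stopped at (upon hitting) $e$. Let $\lambda\ge N^{-1/2}$. Then $$\mathbb{P}\left(\#\mathrm{LE}(R)\le\lambda N^{d/2}\right)\le C\lambda\log\lambda^{-1}.$$
   Context: $T_N^d=\mathbb{Z}^d/(N\mathbb{Z})^d$ is the discrete torus with the graph structure inherited from $\mathbb{Z}^d$. A random walk on $T_N^d$ is the simple (nearest-neighbour) random walk, i.e. the projection to $T_N^d$ of the simple random walk on $\mathbb{Z}^d$. The point $e$ is chosen independently of the steps of the walk. Convention: $\log x$ always means $\max\{\log x,1\}$ (with natural logarithm inside), and $\log 0=1$. For a finite path $\gamma:\{0,\dots,n\}\to T$ in a graph $T$, its loop-erasure $\mathrm{LE}(\gamma)$ is the simple path defined by $\mathrm{LE}(\gamma)_0:=\gamma(0)$ and $\mathrm{LE}(\gamma)_{i+1}:=\gamma(j_i+1)$, where $j_i:=\max\{j:\gamma(j)=\mathrm{LE}(\gamma)_i\}$, for all $i$ such that $j_i<n$ (the path ends at the first $i$ with $j_i=n$). $\#\mathrm{LE}(\gamma)$ is the number of its vertices. *)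

theory Defs
  imports "HOL-Probability.Probability"
begin

definition capped_log :: "real \<Rightarrow> real" where
  "capped_log x = max (ln x) 1"

(* The torus is represented by the residues in {0..<N} of the d coordinates. *)
definition torus :: "nat \<Rightarrow> nat \<Rightarrow> (nat \<Rightarrow> int) set" where
  "torus d N = {..<d} \<rightarrow>\<^sub>E {0..<int N}"

definition torus_proj :: "nat \<Rightarrow> nat \<Rightarrow> (nat \<Rightarrow> int) \<Rightarrow> (nat \<Rightarrow> int)" where
  "torus_proj d N x = (\<lambda>i\<in>{..<d}. x i mod int N)"

definition unit_steps :: "nat \<Rightarrow> (nat \<Rightarrow> int) set" where
  "unit_steps d = {(\<lambda>j. if j = i then s else 0) | i s. i < d \<and> s \<in> {-1, 1}}"

(* Coordinates outside {..<d} are irrelevant: they are discarded by torus_proj. *)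
definition lattice_walk ::
  "(nat \<Rightarrow> int) \<Rightarrow> (nat \<Rightarrow> int) stream \<Rightarrow> nat \<Rightarrow> (nat \<Rightarrow> int)" where
  "lattice_walk b \<omega> n = (\<lambda>i. b i + (\<Sum>k<n. (\<omega> !! k) i))"

definition torus_walk ::
  "nat \<Rightarrow> nat \<Rightarrow> (nat \<Rightarrow> int) \<Rightarrow> (nat \<Rightarrow> int) stream \<Rightarrow> nat \<Rightarrow> (nat \<Rightarrow> int)" where
  "torus_walk d N b \<omega> n = torus_proj d N (lattice_walk b \<omega> n)"

(* Pairs (e, \<omega>): a uniform point of the torus and, independently of it,
   an i.i.d. sequence of uniform unit steps. *)
definition target_and_steps ::
  "nat \<Rightarrow> nat \<Rightarrow> ((nat \<Rightarrow> int) \<times> (nat \<Rightarrow> int) stream) measure" where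
  "target_and_steps d N =
     measure_pmf (pmf_of_set (torus d N)) \<Otimes>\<^sub>M
     stream_space (measure_pmf (pmf_of_set (unit_steps d)))"

(* Unspecified if v is never hit; for the random walk on the torus and v in the torus
   this happens with probability 0. *)
definition hitting_time :: "(nat \<Rightarrow> 'a) \<Rightarrow> 'a \<Rightarrow> nat" where
  "hitting_time \<gamma> v = (LEAST n. \<gamma> n = v)"

(* A finite path is a function \<gamma> together with its length n; only the values of \<gamma> on {..n} matter. *)
definition last_visit :: "(nat \<Rightarrow> 'a) \<Rightarrow> nat \<Rightarrow> 'a \<Rightarrow> nat" where
  "last_visit \<gamma> n v = Max {j. j \<le> n \<and> \<gamma> j = v}"

(* Meaningful for i up to le_end \<gamma> n only. *)
primrec le_vertex :: "(nat \<Rightarrow> 'a) \<Rightarrow> nat \<Rightarrow> nat \<Rightarrow> 'a" where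
  "le_vertex \<gamma> n 0 = \<gamma> 0"
| "le_vertex \<gamma> n (Suc i) = \<gamma> (last_visit \<gamma> n (le_vertex \<gamma> n i) + 1)"

definition le_end :: "(nat \<Rightarrow> 'a) \<Rightarrow> nat \<Rightarrow> nat" where
  "le_end \<gamma> n = (LEAST i. last_visit \<gamma> n (le_vertex \<gamma> n i) = n)"

definition loop_erasure :: "(nat \<Rightarrow> 'a) \<Rightarrow> nat \<Rightarrow> 'a list" where
  "loop_erasure \<gamma> n = map (le_vertex \<gamma> n) [0..<Suc (le_end \<gamma> n)]"

lemma last_visit_props:
  assumes "j \<le> n" "\<gamma> j = v"
  shows "last_visit \<gamma> n v \<le> n" "\<gamma> (last_visit \<gamma> n v) = v" "j \<le> last_visit \<gamma> n v"
proof -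
  let ?S = "{j. j \<le> n \<and> \<gamma> j = v}"
  have fin: "finite ?S" by (rule finite_subset[of _ "{..n}"]) auto
  then have "Max ?S \<in> ?S" using assms by (intro Max_in) auto
  then show "last_visit \<gamma> n v \<le> n" "\<gamma> (last_visit \<gamma> n v) = v"
    by (auto simp: last_visit_def)
  show "j \<le> last_visit \<gamma> n v"
    unfolding last_visit_def using fin assms by (intro Max_ge) auto
qed

lemma le_vertex_step:
  assumes "\<forall>k<i. last_visit \<gamma> n (le_vertex \<gamma> n k) \<noteq> n"
  shows "last_visit \<gamma> n (le_vertex \<gamma> n i) \<le> n \<and> i \<le> last_visit \<gamma> n (le_vertex \<gamma> n i) \<and>
    (\<forall>k<i. last_visit \<gamma> n (le_vertex \<gamma> n k) < last_visit \<gamma> n (le_vertex \<gamma> n i))"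
  using assms
proof (induction i)
  case 0
  show ?case using last_visit_props(1)[of 0 n \<gamma> "\<gamma> 0"] by simp
next
  case (Suc i)
  let ?l = "\<lambda>k. last_visit \<gamma> n (le_vertex \<gamma> n k)"
  have IH: "?l i \<le> n" "i \<le> ?l i" "\<forall>k<i. ?l k < ?l i" using Suc by auto
  moreover have "?l i \<noteq> n" using Suc.prems by simp
  ultimately have le: "?l i + 1 \<le> n" by simp
  have "?l (Suc i) \<le> n" "?l i + 1 \<le> ?l (Suc i)"
    using last_visit_props(1,3)[OF le, of \<gamma>] by simp_all
  then show ?case using IH by (auto simp: less_Suc_eq)
qed

lemma last_visit_le_end: "last_visit \<gamma> n (le_vertex \<gamma> n (le_end \<gamma> n)) = n"
proof -
  have "\<exists>i. last_visit \<gamma> n (le_vertex \<gamma> n i) = n"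
  proof (rule ccontr)
    assume "\<nexists>i. last_visit \<gamma> n (le_vertex \<gamma> n i) = n"
    then show False using le_vertex_step[of "Suc n" \<gamma> n] by auto
  qed
  then show ?thesis unfolding le_end_def by (rule LeastI_ex)
qed

lemma distinct_loop_erasure: "distinct (loop_erasure \<gamma> n)"
proof -
  have lt: "last_visit \<gamma> n (le_vertex \<gamma> n k) < last_visit \<gamma> n (le_vertex \<gamma> n i)"
    if "k < i" "i \<le> le_end \<gamma> n" for i k
    using le_vertex_step[of i \<gamma> n] not_less_Least that unfolding le_end_def
    by (metis (mono_tags, lifting) order_less_le_trans)
  have "inj_on (le_vertex \<gamma> n) {..le_end \<gamma> n}"
    by (rule linorder_inj_onI') (use lt in \<open>force\<close>)
  then show ?thesis
    by (simp add: loop_erasure_def distinct_map atLeast0LessThan lessThan_Suc_atMost del: upt_Suc)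
qed

lemma loop_erasure_endpoints: "hd (loop_erasure \<gamma> n) = \<gamma> 0" "last (loop_erasure \<gamma> n) = \<gamma> n"
proof -
  show "hd (loop_erasure \<gamma> n) = \<gamma> 0"
    by (simp add: loop_erasure_def hd_map del: upt_Suc)
  let ?e = "le_end \<gamma> n"
  have before: "last_visit \<gamma> n (le_vertex \<gamma> n k) \<noteq> n" if "k < ?e" for k
    using that not_less_Least unfolding le_end_def by blast
  have "\<exists>j\<le>n. \<gamma> j = le_vertex \<gamma> n ?e"
  proof (cases ?e)
    case (Suc k)
    have "last_visit \<gamma> n (le_vertex \<gamma> n k) \<le> n" 
      using le_vertex_step[of k \<gamma> n] before Suc by auto
    then show ?thesis using before[of k] Suc
      by (intro exI[of _ "last_visit \<gamma> n (le_vertex \<gamma> n k) + 1"]) auto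
  qed auto
  then have "\<gamma> n = le_vertex \<gamma> n ?e"
    using last_visit_props(2) last_visit_le_end by metis
  then show "last (loop_erasure \<gamma> n) = \<gamma> n" by (simp add: loop_erasure_def)
qed

lemma finite_torus: "finite (torus d N)"
  by (simp add: torus_def finite_PiE)

lemma torus_nonempty: "N > 0 \<Longrightarrow> torus d N \<noteq> {}"
  by (auto simp: torus_def PiE_eq_empty_iff)

lemma finite_unit_steps: "finite (unit_steps d)"
proof -
  have "unit_steps d = (\<lambda>(i, s) j. if j = i then s else 0) ` ({..<d} \<times> {-1, 1})"
    unfolding unit_steps_def by (auto simp: image_def)
  then show ?thesis by simp
qed

lemma unit_steps_nonempty: "d > 0 \<Longrightarrow> unit_steps d \<noteq> {}"
  by (auto simp: unit_steps_def)

lemma torus_walk_in_torus: "N > 0 \<Longrightarrow> torus_walk d N b \<omega> n \<in> torus d N"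
  by (auto simp: torus_walk_def torus_proj_def torus_def)

lemma prob_space_target_and_steps: "prob_space (target_and_steps d N)"
proof -
  interpret A: prob_space "measure_pmf (pmf_of_set (torus d N))"
    by (rule measure_pmf.prob_space_axioms)
  interpret S: prob_space "stream_space (measure_pmf (pmf_of_set (unit_steps d)))"
    by (rule prob_space.prob_space_stream_space, rule measure_pmf.prob_space_axioms)
  interpret pair_prob_space "measure_pmf (pmf_of_set (torus d N))"
    "stream_space (measure_pmf (pmf_of_set (unit_steps d)))" ..
  show ?thesis unfolding target_and_steps_def by (rule prob_space_axioms)
qed

lemma measurable_torus_walk:
  assumes N: "N > 0"
  shows "(\<lambda>\<omega>. torus_walk d N b \<omega> n) \<in>
    stream_space (measure_pmf p) \<rightarrow>\<^sub>M count_space (torus d N)"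
  unfolding measurable_count_space_eq2[OF finite_torus]
proof safe
  fix \<omega> show "torus_walk d N b \<omega> n \<in> torus d N" by (rule torus_walk_in_torus[OF N])
next
  fix a assume a: "a \<in> torus d N"
  let ?M = "stream_space (measure_pmf p)"
  have [measurable]: "(\<lambda>\<omega>. (\<omega> !! k) i) \<in> ?M \<rightarrow>\<^sub>M count_space UNIV" for k i
    by (rule measurable_compose[OF measurable_snth]) simp
  have eq: "(\<lambda>\<omega>. torus_walk d N b \<omega> n) -` {a} \<inter> space ?M =
      {\<omega> \<in> space ?M. \<forall>i\<in>{..<d}. (b i + (\<Sum>k<n. (\<omega> !! k) i)) mod int N = a i}"
    using a by (auto simp: torus_walk_def torus_proj_def lattice_walk_def torus_def fun_eq_iff PiE_def
        extensional_def restrict_def)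
  have sm: "(\<lambda>\<omega>. \<Sum>k<n. (\<omega> !! k) i) \<in> ?M \<rightarrow>\<^sub>M count_space UNIV" for i
  proof (induction n)
    case (Suc n)
    note [measurable] = Suc
    have "(\<lambda>\<omega>. (\<Sum>k<n. (\<omega> !! k) i) + (\<omega> !! n) i) \<in> ?M \<rightarrow>\<^sub>M count_space UNIV"
      by (rule measurable_compose_countable[OF _ Suc],
          rule measurable_compose_countable[where f = "\<lambda>y \<omega>. x + y" for x]) auto
    then show ?case by simp
  qed simp
  have "Measurable.pred ?M (\<lambda>\<omega>. (b i + (\<Sum>k<n. (\<omega> !! k) i)) mod int N = a i)" for i
    by (rule measurable_compose[OF sm[of i], of "\<lambda>x. (b i + x) mod int N = a i"]) simp
  then show "(\<lambda>\<omega>. torus_walk d N b \<omega> n) -` {a} \<inter> space ?M \<in> sets ?M"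
    unfolding eq by measurable
qed

lemma measurable_loop_erasure_length:
  fixes X :: "nat \<Rightarrow> 'b \<Rightarrow> 'a" and v :: "'b \<Rightarrow> 'a"
  assumes fin: "finite T" and X: "\<And>n. X n \<in> M \<rightarrow>\<^sub>M count_space T"
    and v: "\<And>t. t \<in> T \<Longrightarrow> Measurable.pred M (\<lambda>x. t = v x)"
  shows "(\<lambda>x. card (set (loop_erasure (\<lambda>n. X n x) (hitting_time (\<lambda>n. X n x) (v x)))))
    \<in> M \<rightarrow>\<^sub>M count_space UNIV"
proof -
  have cT: "countable T" using fin by (rule countable_finite)
  have [measurable]: "Measurable.pred M (\<lambda>x. X n x = v x)" for n
    by (rule measurable_compose_countable'[OF v X cT])
  have [measurable]: "(\<lambda>x. hitting_time (\<lambda>n. X n x) (v x)) \<in> M \<rightarrow>\<^sub>M count_space UNIV"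
    unfolding hitting_time_def by measurable
  have XU[measurable]: "Measurable.pred M (\<lambda>x. X n x = t)" for n t
    by (rule measurable_compose[OF X, of "\<lambda>y. y = t"]) simp
  have lv[measurable]: "(\<lambda>x. last_visit (\<lambda>n. X n x) n t) \<in> M \<rightarrow>\<^sub>M count_space UNIV" for n t
    unfolding last_visit_def by measurable
  have lev: "(\<lambda>x. le_vertex (\<lambda>n. X n x) n i) \<in> M \<rightarrow>\<^sub>M count_space T" for n i
  proof (induction i)
    case (Suc i)
    have "(\<lambda>x. last_visit (\<lambda>n. X n x) n (le_vertex (\<lambda>n. X n x) n i)) \<in> M \<rightarrow>\<^sub>M count_space UNIV"
      by (rule measurable_compose_countable'[OF lv Suc cT])
    from measurable_compose_countable[OF X this, of "\<lambda>k. k + 1"]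
    show ?case by simp
  qed (simp add: X)
  have levl[measurable]:
    "(\<lambda>x. last_visit (\<lambda>n. X n x) n (le_vertex (\<lambda>n. X n x) n i)) \<in> M \<rightarrow>\<^sub>M count_space UNIV" for n i
    by (rule measurable_compose_countable'[OF lv lev cT])
  have [measurable]: "(\<lambda>x. le_end (\<lambda>n. X n x) n) \<in> M \<rightarrow>\<^sub>M count_space UNIV" for n
    unfolding le_end_def by measurable
  have "(\<lambda>x. card (set (loop_erasure (\<lambda>n. X n x) n))) \<in> M \<rightarrow>\<^sub>M count_space UNIV" for n
    unfolding distinct_card[OF distinct_loop_erasure] by (simp add: loop_erasure_def)
  then show ?thesis
    by (rule measurable_compose_countable) measurable
qed

lemma sets_short_loop_erasure:
  assumes N: "N > 0"
  shows "{(e, \<omega>) \<in> space (target_and_steps d N).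
      real (card (set (loop_erasure (torus_walk d N b \<omega>) (hitting_time (torus_walk d N b \<omega>) e)))) \<le> c}
    \<in> sets (target_and_steps d N)"
proof -
  let ?M = "target_and_steps d N"
  have 1: "(\<lambda>x. torus_walk d N b (snd x) n) \<in> ?M \<rightarrow>\<^sub>M count_space (torus d N)" for n
    unfolding target_and_steps_def
    by (rule measurable_compose[OF measurable_snd measurable_torus_walk[OF N]])
  have 2: "Measurable.pred ?M (\<lambda>x. t = fst x)" for t
    unfolding target_and_steps_def
    by (rule measurable_compose[OF measurable_fst]) simp
  have "(\<lambda>x. card (set (loop_erasure (\<lambda>n. torus_walk d N b (snd x) n)
      (hitting_time (\<lambda>n. torus_walk d N b (snd x) n) (fst x))))) \<in> ?M \<rightarrow>\<^sub>M count_space UNIV"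
    by (rule measurable_loop_erasure_length[OF finite_torus 1 2])
  then have "Measurable.pred ?M (\<lambda>x. real (card (set (loop_erasure (torus_walk d N b (snd x))
      (hitting_time (torus_walk d N b (snd x)) (fst x))))) \<le> c)"
    by (rule measurable_compose[where g = "\<lambda>k. real k \<le> c"]) simp
  then have "{x \<in> space ?M. real (card (set (loop_erasure (torus_walk d N b (snd x))
      (hitting_time (torus_walk d N b (snd x)) (fst x))))) \<le> c} \<in> sets ?M"
    by (simp add: pred_def)
  then show ?thesis by (rule back_subst[of "\<lambda>A. A \<in> sets ?M"]) auto
qed

end

theory Submission
  imports Defs
begin

text \<open>
  Write \<open>X\<close> for the walk, \<open>n = N^(d/2)\<close>, \<open>s = lam * n\<close>, and \<open>T\<close> for the hitting time of \<open>e\<close>. Two estimates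
  give the theorem. First, \<open>T\<close> exceeds \<open>N^d / lam\<close> with probability \<open>O(lam)\<close>. Second, at each fixed
  time \<open>t\<close> that is at least a constant times \<open>s\<close>, the loop-erasure of \<open>X\<close> up to \<open>t\<close> has at most \<open>s\<close>
  vertices with probability \<open>O(lam^2)\<close>. Since \<open>e\<close> is uniform and independent of the steps, the probability that
  \<open>X\<close> hits \<open>e\<close> at time \<open>t\<close> with a short loop-erasure is at most \<open>N^(-d)\<close> times the probability that the
  loop-erasure at time \<open>t\<close> is short. Summing over the times \<open>t < N^d / lam\<close> gives
  \<open>O(N^(-d) * (N^d / lam) * lam^2) = O(lam)\<close>. The times \<open>t = O(s)\<close>, for which the second estimate is not available,
  contribute \<open>O(s / N^d)\<close>, which is also \<open>O(lam)\<close>. The bound \<open>C * lam\<close> obtained in this way is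
  stronger than the one asserted, as the capped logarithm is at least 1.

  The analytic input is Fourier analysis on the torus: the transition probabilities after \<open>k\<close> steps are
  \<open>O((k^(-1/2) + 1/N)^d)\<close> (\<open>abs_fourier_mean_le\<close>), and the Green function with its equilibrium part removed is bounded
  uniformly in \<open>N\<close> (\<open>spectral_green_le\<close>).

  The bound on \<open>T\<close> is Chebyshev's inequality for the number of visits to \<open>e\<close> before a fixed time: the variance, averaged
  over \<open>e\<close>, is controlled by the Green function (\<open>mean_prob_not_hit_le\<close>).

  For the fixed-time estimate, the times before \<open>t\<close> are split at \<open>u < v < t\<close> with gaps of order \<open>s\<close>. If the loop-erasure
  at time \<open>t\<close> has at most \<open>r\<close> vertices, then either \<open>X\<close> returns after time \<open>v\<close> to one of the first \<open>r\<close> vertices of the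
  loop-erasure at time \<open>u\<close>, or among the many disjoint windows of constant length \<open>a\<close> between \<open>v\<close> and \<open>t\<close> at most \<open>r\<close>
  are crossed by no loop that starts after \<open>u\<close> (\<open>short_loop_erasure_cases\<close>). Since \<open>v - u\<close> is at least \<open>N^2\<close>, the
  walk has equilibrated by time \<open>v\<close>, so the first event has probability \<open>O(s * s / N^d) = O(lam^2)\<close>. In dimension at
  least 5 the expected number of loops across a window of length \<open>a\<close> is small for large \<open>a\<close>, and distant windows are
  almost independent. Chebyshev's inequality then bounds the probability of the second event by
  \<open>O(s^(-1/2) + s^2 / N^d)\<close> (\<open>prob_few_cut_windows_le\<close>). The assumption \<open>lam \<ge> N^(-1/2)\<close> is what makes
  \<open>s \<ge> N^2\<close> and \<open>s^(-1/2) \<le> lam^2\<close> (\<open>short_scale_bounds\<close>).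
\<close>

section \<open>Loop-erasures and cut windows\<close>

text \<open>
  Freezing the path at time \<open>u\<close> makes the set a function of the path up to time \<open>u\<close> only, also for indices beyond the
  end of the loop-erasure, where \<open>le_vertex\<close> would look at time \<open>u + 1\<close>.
\<close>

definition le_prefix :: "(nat \<Rightarrow> 'a) \<Rightarrow> nat \<Rightarrow> nat \<Rightarrow> 'a set" where
  "le_prefix \<gamma> u r = le_vertex (\<lambda>j. \<gamma> (min j u)) u ` {..<r}"

lemma last_visit_le_vertex:
  assumes "i \<le> le_end \<gamma> t"
  shows "last_visit \<gamma> t (le_vertex \<gamma> t i) \<le> t"
    "\<gamma> (last_visit \<gamma> t (le_vertex \<gamma> t i)) = le_vertex \<gamma> t i"
    "k < i \<Longrightarrow> last_visit \<gamma> t (le_vertex \<gamma> t k) < last_visit \<gamma> t (le_vertex \<gamma> t i)"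
proof -
  have ne: "\<forall>k<i. last_visit \<gamma> t (le_vertex \<gamma> t k) \<noteq> t"
    using assms not_less_Least unfolding le_end_def by (metis (mono_tags, lifting) order_less_le_trans)
  show "last_visit \<gamma> t (le_vertex \<gamma> t i) \<le> t"
    "k < i \<Longrightarrow> last_visit \<gamma> t (le_vertex \<gamma> t k) < last_visit \<gamma> t (le_vertex \<gamma> t i)"
    using le_vertex_step[OF ne] by auto
  show "\<gamma> (last_visit \<gamma> t (le_vertex \<gamma> t i)) = le_vertex \<gamma> t i"
  proof (cases i)
    case 0
    then show ?thesis using last_visit_props(2)[of 0 t \<gamma> "\<gamma> 0"] by simp
  next
    case (Suc k)
    then have "last_visit \<gamma> t (le_vertex \<gamma> t k) < t"
      using le_vertex_step[OF ne] by (metis lessI order_less_le_trans)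
    then show ?thesis
      using last_visit_props(2)[of "last_visit \<gamma> t (le_vertex \<gamma> t k) + 1" t \<gamma>] Suc by simp
  qed
qed

text \<open>
  A vertex whose last visit before \<open>t\<close> precedes \<open>u\<close> is left for good at the same time by the path up to
  \<open>t\<close> and by the path frozen at \<open>u\<close>, so the two loop-erasures agree until one of their vertices is visited again after \<open>u\<close>.
\<close>

lemma le_vertex_initial_segment:
  assumes "u \<le> t" "i \<le> le_end \<gamma> t"
    and "\<And>k. k < i \<Longrightarrow> last_visit \<gamma> t (le_vertex \<gamma> t k) < u"
  shows "le_vertex \<gamma> t i = le_vertex (\<lambda>j. \<gamma> (min j u)) u i"
  using assms(2,3)
proof (induction i)
  case (Suc i)
  define w where "w = le_vertex \<gamma> t i"
  define l where "l = last_visit \<gamma> t w"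
  have l: "l < u" using Suc.prems(2)[of i] by (simp add: l_def w_def)
  have w: "le_vertex (\<lambda>j. \<gamma> (min j u)) u i = w"
    using Suc.IH Suc.prems by (simp add: w_def)
  have "j \<le> l" if "j \<le> t" "\<gamma> j = w" for j
    using last_visit_props(3)[of j t \<gamma> w] that by (simp add: l_def)
  moreover have "\<gamma> l = w" using last_visit_le_vertex(2)[of i \<gamma> t] Suc.prems by (simp add: l_def w_def)
  ultimately have "{j. j \<le> u \<and> \<gamma> (min j u) = w} = {j. j \<le> t \<and> \<gamma> j = w}"
    using l \<open>u \<le> t\<close> by (force simp: min_def)
  then have "last_visit (\<lambda>j. \<gamma> (min j u)) u w = l"
    by (simp add: last_visit_def l_def)
  then show ?case using l w by (simp add: w_def[symmetric] l_def[symmetric] min_def)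
qed simp

text \<open>
  No loop of the path restricted to \<open>{u..t}\<close> crosses the window between \<open>\<alpha>\<close> and \<open>\<beta>\<close>.
  Windows take the place of cut times, for which even the positivity of the probability needs an argument.
\<close>

definition cut_window :: "(nat \<Rightarrow> 'a) \<Rightarrow> nat \<Rightarrow> nat \<Rightarrow> nat \<Rightarrow> nat \<Rightarrow> bool" where
  "cut_window \<gamma> u \<alpha> \<beta> t \<longleftrightarrow> (\<forall>x\<in>{u..\<alpha>}. \<forall>y\<in>{\<beta>..t}. \<gamma> x \<noteq> \<gamma> y)"

text \<open>
  Let \<open>i\<close> be the first index whose last visit is at time \<open>u\<close> or later. The \<open>i\<close>-th vertex belongs to the loop-erasure at
  time \<open>u\<close>, so if the path avoids that part after \<open>v\<close>, the last visit to it is before \<open>v\<close>. From then on the loop-erasure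
  follows the path after \<open>u\<close>, and jumps in time from the first entrance to a vertex after \<open>u\<close> to its last visit. Such a
  jump is a loop, so it cannot cross a cut window: each cut window contains the last visit to some vertex, and disjoint
  windows yield distinct vertices.
\<close>

lemma short_loop_erasure_cases:
  assumes "u \<le> v" "v + Q * a \<le> t" and short: "card (set (loop_erasure \<gamma> t)) \<le> r"
  shows "(\<exists>y\<in>{v..t}. \<gamma> y \<in> le_prefix \<gamma> u r) \<or>
    card {q. q < Q \<and> cut_window \<gamma> u (v + q * a) (v + Suc q * a) t} \<le> r"
proof (rule disjCI)
  let ?l = "\<lambda>i. last_visit \<gamma> t (le_vertex \<gamma> t i)" and ?e = "le_end \<gamma> t"
  define G where "G = {q. q < Q \<and> cut_window \<gamma> u (v + q * a) (v + Suc q * a) t}"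
  assume far: "\<not> card {q. q < Q \<and> cut_window \<gamma> u (v + q * a) (v + Suc q * a) t} \<le> r"
  have card: "card (set (loop_erasure \<gamma> t)) = Suc ?e"
    unfolding distinct_card[OF distinct_loop_erasure] by (simp add: loop_erasure_def)
  have fa: "u \<le> t" using assms by linarith
  have le: "?l ?e = t" by (rule last_visit_le_end)
  define i where "i = (LEAST i. u \<le> ?l i)"
  have i: "u \<le> ?l i" unfolding i_def by (rule LeastI[of _ ?e]) (use le fa in simp)
  have ie: "i \<le> ?e" unfolding i_def by (rule Least_le) (use le fa in simp)
  have below: "?l k < u" if "k < i" for k using not_less_Least[OF that[unfolded i_def]] by simp
  have "le_vertex \<gamma> t i \<in> le_prefix \<gamma> u r"
    using le_vertex_initial_segment[OF fa ie below] ie short card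
    by (auto simp: le_prefix_def)
  then have hit: "\<gamma> (?l i) \<in> le_prefix \<gamma> u r" using last_visit_le_vertex(2)[OF ie] by simp
  show "\<exists>y\<in>{v..t}. \<gamma> y \<in> le_prefix \<gamma> u r"
  proof (rule ccontr)
    assume no: "\<not> ?thesis"
    then have liv: "?l i < v" using hit last_visit_le_vertex(1)[OF ie] by (metis atLeastAtMost_iff not_less)
    \<comment> \<open>the first vertex whose last visit does not precede the window; that visit lies inside the window\<close>
    define f where "f q = (LEAST k. v + q * a \<le> ?l k)" for q
    have f: "f q \<le> ?e \<and> v + q * a \<le> ?l (f q) \<and> ?l (f q) < v + Suc q * a" if q: "q \<in> G" for q
    proof -
      have "Suc q * a \<le> Q * a" using q by (intro mult_le_mono1) (auto simp: G_def)
      then have vt: "v + q * a \<le> t" using assms(2) by simp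
      have 1: "v + q * a \<le> ?l (f q)" unfolding f_def by (rule LeastI[of _ ?e]) (use le vt in simp)
      have 2: "f q \<le> ?e" unfolding f_def by (rule Least_le) (use le vt in simp)
      have "i < f q"
      proof (rule ccontr)
        assume "\<not> i < f q"
        then have "?l (f q) \<le> ?l i" using last_visit_le_vertex(3)[OF ie, of "f q"]
          by (cases "f q = i") auto
        then show False using 1 liv by simp
      qed
      then obtain k where k: "f q = Suc k" "i \<le> k" by (cases "f q") auto
      have lk: "?l k < v + q * a" using not_less_Least[of k "\<lambda>k. v + q * a \<le> ?l k"] k(1)
        by (auto simp: f_def[symmetric])
      have uk: "u \<le> ?l k" using i k 2 last_visit_le_vertex(3)[of k \<gamma> t i] by (cases "i = k") auto
      have "\<gamma> (?l k + 1) = \<gamma> (?l (f q))" using last_visit_le_vertex(2)[OF 2] k(1) by simp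
      moreover have "?l (f q) \<le> t" using last_visit_le_vertex(1)[OF 2] .
      ultimately have "?l (f q) < v + Suc q * a"
        using q lk uk unfolding G_def cut_window_def
        by (metis (mono_tags, lifting) Suc_eq_plus1 Suc_leI atLeastAtMost_iff le_SucI mem_Collect_eq not_less)
      then show ?thesis using 1 2 by simp
    qed
    have "inj_on f G"
    proof (rule linorder_inj_onI')
      fix q q' assume "q \<in> G" "q' \<in> G" "q < q'"
      moreover from this have "Suc q * a \<le> q' * a" by (intro mult_le_mono1) auto
      ultimately show "f q \<noteq> f q'" using f[of q] f[of q'] by (metis add_le_cancel_left le_trans not_less)
    qed
    moreover have "f ` G \<subseteq> {..?e}" using f by auto
    ultimately have "card G \<le> card {..?e}" by (intro card_inj_on_le) auto
    then show False using far short card by (simp add: G_def)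
  qed
qed

section \<open>From streams of steps to finite lists\<close>

lemma prob_bind_pmf:
  "measure_pmf.prob (bind_pmf p f) A = measure_pmf.expectation p (\<lambda>x. measure_pmf.prob (f x) A)"
proof -
  have "ennreal (measure_pmf.prob (bind_pmf p f) A) = (\<integral>\<^sup>+x. ennreal (measure_pmf.prob (f x) A) \<partial>p)"
    by (simp add: measure_pmf.emeasure_eq_measure[symmetric])
  also have "\<dots> = ennreal (measure_pmf.expectation p (\<lambda>x. measure_pmf.prob (f x) A))"
    by (intro nn_integral_eq_integral measure_pmf.integrable_const_bound[of _ 1]) auto
  finally show ?thesis by (simp add: integral_nonneg_AE)
qed

lemma prob_pair_pmf:
  "measure_pmf.prob (pair_pmf p q) {(x, y). \<Psi> x y}
    = measure_pmf.expectation p (\<lambda>x. measure_pmf.prob q {y. \<Psi> x y})"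
proof -
  have "pair_pmf p q = bind_pmf p (\<lambda>x. map_pmf (Pair x) q)"
    by (simp add: pair_pmf_def map_pmf_def)
  then show ?thesis by (simp add: prob_bind_pmf vimage_def)
qed

lemma prob_pair_pmf_le:
  assumes "\<And>x. measure_pmf.prob q {y. \<Psi> x y} \<le> B"
  shows "measure_pmf.prob (pair_pmf p q) {(x, y). \<Psi> x y} \<le> B"
proof -
  have "measure_pmf.expectation p (\<lambda>x. measure_pmf.prob q {y. \<Psi> x y}) \<le> measure_pmf.expectation p (\<lambda>x. B)"
    using assms by (intro integral_mono) (auto intro: measure_pmf.integrable_const_bound[of _ 1])
  then show ?thesis by (simp add: prob_pair_pmf)
qed

lemma prob_pair_pmf_indep:
  "measure_pmf.prob (pair_pmf p q) {(x, y). \<Phi> x \<and> \<Psi> y}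
    = measure_pmf.prob p {x. \<Phi> x} * measure_pmf.prob q {y. \<Psi> y}"
proof -
  have "measure_pmf.prob (pair_pmf p q) {(x, y). \<Phi> x \<and> \<Psi> y}
      = measure_pmf.expectation p (\<lambda>x. indicator {x. \<Phi> x} x * measure_pmf.prob q {y. \<Psi> y})"
    unfolding prob_pair_pmf by (intro Bochner_Integration.integral_cong) (auto simp: indicator_def)
  then show ?thesis by simp
qed

lemma split_replicate_pmf:
  assumes "m \<le> n"
  shows "map_pmf (\<lambda>xs. (take m xs, drop m xs)) (replicate_pmf n p)
    = pair_pmf (replicate_pmf m p) (replicate_pmf (n - m) p)"
proof -
  have "map_pmf (\<lambda>xs. (take m xs, drop m xs)) (replicate_pmf (m + (n - m)) p)
    = pair_pmf (replicate_pmf m p) (replicate_pmf (n - m) p)"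
    unfolding replicate_pmf_distrib map_bind_pmf pair_pmf_def
    by (intro bind_pmf_cong refl) (auto simp: set_replicate_pmf)
  then show ?thesis using assms by simp
qed

lemma prob_split_replicate_pmf:
  assumes "m \<le> n"
  shows "measure_pmf.prob (replicate_pmf n p) {xs. \<Psi> (take m xs) (drop m xs)}
    = measure_pmf.prob (pair_pmf (replicate_pmf m p) (replicate_pmf (n - m) p)) {(x, y). \<Psi> x y}"
  unfolding split_replicate_pmf[OF assms, symmetric] by (simp add: vimage_def)

lemma prob_slice_replicate_pmf:
  assumes "m + k \<le> n"
  shows "measure_pmf.prob (replicate_pmf n p) {xs. \<Phi> (take k (drop m xs))}
    = measure_pmf.prob (replicate_pmf k p) {xs. \<Phi> xs}"
proof -
  have "measure_pmf.prob (replicate_pmf n p) {xs. \<Phi> (take k (drop m xs))}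
    = measure_pmf.prob (replicate_pmf (n - m) p) {xs. \<Phi> (take k xs)}"
    using assms prob_split_replicate_pmf[of m n p "\<lambda>x y. \<Phi> (take k y)"]
      prob_pair_pmf_indep[of "replicate_pmf m p" "replicate_pmf (n - m) p" "\<lambda>x. True"] by simp
  also have "\<dots> = measure_pmf.prob (replicate_pmf k p) {xs. \<Phi> xs}"
    using assms prob_split_replicate_pmf[of k "n - m" p "\<lambda>x y. \<Phi> x"]
      prob_pair_pmf_indep[of "replicate_pmf k p" "replicate_pmf (n - m - k) p" _ "\<lambda>x. True"] by simp
  finally show ?thesis .
qed

text \<open>
  The initial segments of the stream are compared with the discrete distribution on lists one list at a time, as
  \<open>stake\<close> need not be measurable into the full power set when the type of steps is uncountable.
\<close>

lemma emeasure_stake_eq: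
  fixes p :: "'a pmf"
  shows "{\<omega> \<in> space (stream_space (measure_pmf p)). stake n \<omega> = xs} \<in> sets (stream_space (measure_pmf p))
    \<and> (length xs = n \<longrightarrow> emeasure (stream_space (measure_pmf p)) {\<omega> \<in> space (stream_space (measure_pmf p)). stake n \<omega> = xs}
    = emeasure (replicate_pmf n p) {xs})"
proof (induction n arbitrary: xs)
  case 0
  interpret S: prob_space "stream_space (measure_pmf p)"
    by (rule prob_space.prob_space_stream_space[OF measure_pmf.prob_space_axioms])
  show ?case by (auto simp: S.emeasure_space_1)
next
  case (Suc n)
  let ?S = "stream_space (measure_pmf p)"
  have [measurable]: "{y} \<in> sets (measure_pmf p)" for y by simp
  have [measurable]: "Measurable.pred ?S (\<lambda>\<omega>. stake n \<omega> = ys)" for ys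
    using Suc.IH[of ys] by (simp add: pred_def)
  have [measurable]: "Measurable.pred ?S (\<lambda>\<omega>. stake n (stl \<omega>) = ys)" for ys
    by (rule measurable_compose[of stl _ ?S]) simp_all
  have [measurable]: "Measurable.pred ?S (\<lambda>\<omega>. shd \<omega> = y)" for y
    by (rule measurable_compose[of shd _ "measure_pmf p"]) simp_all
  have meas: "{\<omega> \<in> space ?S. stake (Suc n) \<omega> = xs} \<in> sets ?S"
    by (cases xs) simp_all
  show ?case
  proof (intro conjI impI meas)
    assume "length xs = Suc n"
    then obtain x ys where xs: "xs = x # ys" "length ys = n" by (cases xs) auto
    have "emeasure ?S {\<omega> \<in> space ?S. stake (Suc n) \<omega> = xs}
      = (\<integral>\<^sup>+t. emeasure ?S {\<omega> \<in> space ?S. t ## \<omega> \<in> {\<omega> \<in> space ?S. stake (Suc n) \<omega> = xs}} \<partial>p)"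
      by (rule prob_space.emeasure_stream_space[OF measure_pmf.prob_space_axioms meas])
    also have "\<dots> = (\<integral>\<^sup>+t. emeasure (replicate_pmf n p) ((#) t -` {xs}) \<partial>p)"
    proof (rule nn_integral_cong)
      fix t
      show "emeasure ?S {\<omega> \<in> space ?S. t ## \<omega> \<in> {\<omega> \<in> space ?S. stake (Suc n) \<omega> = xs}}
        = emeasure (replicate_pmf n p) ((#) t -` {xs})"
      proof (cases "t = x")
        case True
        then have "{\<omega> \<in> space ?S. t ## \<omega> \<in> {\<omega> \<in> space ?S. stake (Suc n) \<omega> = xs}} = {\<omega> \<in> space ?S. stake n \<omega> = ys}"
          "(#) t -` {xs} = {ys}"
          using xs by (auto simp: space_stream_space)
        then show ?thesis using Suc.IH[of ys] xs by simp
      next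
        case False
        then have "{\<omega> \<in> space ?S. t ## \<omega> \<in> {\<omega> \<in> space ?S. stake (Suc n) \<omega> = xs}} = {}"
          "(#) t -` {xs} = {}" using xs by auto
        then show ?thesis by (simp only: emeasure_empty)
      qed
    qed
    also have "\<dots> = emeasure (replicate_pmf (Suc n) p) {xs}"
      unfolding replicate_pmf.simps map_pmf_def[symmetric] by simp
    finally show "emeasure ?S {\<omega> \<in> space ?S. stake (Suc n) \<omega> = xs} = emeasure (replicate_pmf (Suc n) p) {xs}" .
  qed
qed

text \<open>
  Reduces estimates on the stream space to a finite probability space, in which every set is measurable.
\<close>

lemma stream_prob_le_list_prob:
  fixes p :: "'a pmf"
  assumes E: "E \<in> sets (stream_space (measure_pmf p))" and fin: "finite (set_pmf p)"
    and \<Phi>: "\<And>\<omega>. \<omega> \<in> E \<Longrightarrow> \<Phi> (stake n \<omega>)"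
  shows "measure (stream_space (measure_pmf p)) E \<le> measure_pmf.prob (replicate_pmf n p) {xs. \<Phi> xs}"
proof -
  let ?S = "stream_space (measure_pmf p)" and ?R = "set_pmf (replicate_pmf n p)"
  interpret S: prob_space ?S by (rule prob_space.prob_space_stream_space[OF measure_pmf.prob_space_axioms])
  define F where "F xs = {\<omega> \<in> space ?S. stake n \<omega> = xs}" for xs
  have F[measurable]: "F xs \<in> sets ?S" for xs using emeasure_stake_eq[of p n xs] by (simp add: F_def)
  have mF: "S.prob (F xs) = pmf (replicate_pmf n p) xs" if "xs \<in> ?R" for xs
    using emeasure_stake_eq[of p n xs] that
    by (simp add: F_def set_replicate_pmf S.emeasure_eq_measure measure_pmf.emeasure_eq_measure
        measure_pmf_single)
  have finR: "finite ?R" by (simp add: set_replicate_pmf lists_eq_set finite_lists_length_eq[OF fin])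
  have sum: "S.prob (\<Union>xs\<in>A. F xs) = measure_pmf.prob (replicate_pmf n p) A" if "A \<subseteq> ?R" for A
  proof -
    have fA: "finite A" using that finR by (rule finite_subset)
    have "S.prob (\<Union>xs\<in>A. F xs) = (\<Sum>xs\<in>A. S.prob (F xs))"
    proof (rule S.finite_measure_finite_Union[OF fA])
      show "F ` A \<subseteq> S.events" using F by auto
      show "disjoint_family_on F A" by (auto simp: disjoint_family_on_def F_def)
    qed
    also have "\<dots> = (\<Sum>xs\<in>A. pmf (replicate_pmf n p) xs)"
      using that mF by (intro sum.cong) auto
    finally show ?thesis by (simp add: measure_measure_pmf_finite[OF fA])
  qed
  let ?A = "{xs\<in>?R. \<Phi> xs}"
  have fA: "finite ?A" using finR by simp
  have U[measurable]: "(\<Union>xs\<in>?R. F xs) \<in> sets ?S" using finR by (intro sets.finite_UN) auto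
  have UA: "(\<Union>xs\<in>?A. F xs) \<in> sets ?S" by (intro sets.finite_UN fA) auto
  have "E \<subseteq> (\<Union>xs\<in>?A. F xs) \<union> (space ?S - (\<Union>xs\<in>?R. F xs))"
    using \<Phi> sets.sets_into_space[OF E] by (auto simp: F_def)
  then have "S.prob E \<le> S.prob ((\<Union>xs\<in>?A. F xs) \<union> (space ?S - (\<Union>xs\<in>?R. F xs)))"
    using UA by (intro S.finite_measure_mono sets.Un) auto
  also have "\<dots> \<le> S.prob (\<Union>xs\<in>?A. F xs) + S.prob (space ?S - (\<Union>xs\<in>?R. F xs))"
    using UA by (intro measure_Un_le) auto
  also have "S.prob (space ?S - (\<Union>xs\<in>?R. F xs)) = 0"
    using sum[of ?R] by (subst S.prob_compl[OF U]) (simp add: measure_pmf.prob_eq_1 AE_measure_pmf)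
  also have "S.prob (\<Union>xs\<in>?A. F xs) = measure_pmf.prob (replicate_pmf n p) ?A"
    by (rule sum) auto
  also have "\<dots> \<le> measure_pmf.prob (replicate_pmf n p) {xs. \<Phi> xs}"
    by (intro measure_pmf.finite_measure_mono) auto
  finally show ?thesis by simp
qed

section \<open>The walk driven by a list of steps\<close>

definition list_walk :: "nat \<Rightarrow> nat \<Rightarrow> (nat \<Rightarrow> int) \<Rightarrow> (nat \<Rightarrow> int) list \<Rightarrow> nat \<Rightarrow> (nat \<Rightarrow> int)" where
  "list_walk d N b xs n = torus_proj d N (\<lambda>i. b i + (\<Sum>x\<leftarrow>take n xs. x i))"

abbreviation step_lists :: "nat \<Rightarrow> nat \<Rightarrow> (nat \<Rightarrow> int) list pmf" where
  "step_lists d n \<equiv> replicate_pmf n (pmf_of_set (unit_steps d))"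

text \<open>
  The transition probability of the walk on the torus after \<open>k\<close> steps, as a function of the displacement \<open>z\<close>.
\<close>

definition walk_kernel :: "nat \<Rightarrow> nat \<Rightarrow> nat \<Rightarrow> (nat \<Rightarrow> int) \<Rightarrow> real" where
  "walk_kernel d N k z = measure_pmf.prob (step_lists d k) {xs. \<forall>i<d. int N dvd (\<Sum>x\<leftarrow>xs. x i) - z i}"

lemma torus_walk_eq_list_walk:
  assumes "n \<le> m"
  shows "torus_walk d N b \<omega> n = list_walk d N b (stake m \<omega>) n"
proof -
  have "take n (stake m \<omega>) = stake n \<omega>" using assms by (simp add: take_stake)
  moreover have "(\<Sum>x\<leftarrow>stake n \<omega>. x i) = (\<Sum>k<n. (\<omega> !! k) i)" for i
    by (simp add: sum_list_sum_nth atLeast0LessThan)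
  ultimately show ?thesis
    by (simp add: torus_walk_def lattice_walk_def list_walk_def)
qed

lemma torus_proj_eq_iff:
  "torus_proj d N x = torus_proj d N y \<longleftrightarrow> (\<forall>i<d. int N dvd x i - y i)"
  by (auto simp: torus_proj_def fun_eq_iff restrict_def mod_eq_dvd_iff)

lemma list_walk_in_torus: "N > 0 \<Longrightarrow> list_walk d N b xs n \<in> torus d N"
  by (auto simp: list_walk_def torus_proj_def torus_def)

lemma torus_proj_torus: "z \<in> torus d N \<Longrightarrow> torus_proj d N z = z"
  by (auto simp: torus_proj_def torus_def fun_eq_iff restrict_def PiE_iff extensional_def)

lemma list_walk_eq_iff:
  assumes "x \<le> y"
  shows "list_walk d N b xs x = list_walk d N b xs y
    \<longleftrightarrow> (\<forall>i<d. int N dvd (\<Sum>s\<leftarrow>take (y - x) (drop x xs). s i))"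
proof -
  have "take y xs = take x xs @ take (y - x) (drop x xs)"
    using assms by (metis le_add_diff_inverse take_add)
  then have "(\<Sum>s\<leftarrow>take y xs. s i) = (\<Sum>s\<leftarrow>take x xs. s i) + (\<Sum>s\<leftarrow>take (y - x) (drop x xs). s i)" for i
    by simp
  then show ?thesis
    unfolding list_walk_def torus_proj_eq_iff
    by (intro all_cong1 imp_cong refl) (auto simp: algebra_simps dvd_diff_commute)
qed

lemma prob_return:
  assumes "x \<le> y" "y \<le> n"
  shows "measure_pmf.prob (step_lists d n) {xs. list_walk d N b xs x = list_walk d N b xs y}
    = walk_kernel d N (y - x) (\<lambda>_. 0)"
  unfolding list_walk_eq_iff[OF assms(1)] walk_kernel_def
  using prob_slice_replicate_pmf[of x "y - x" n "pmf_of_set (unit_steps d)"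
      "\<lambda>ys. \<forall>i<d. int N dvd (\<Sum>s\<leftarrow>ys. s i)"] assms by simp

text \<open>
  The Markov property at time \<open>u\<close>: the target is fixed once the first \<open>u\<close> steps are known, and the remaining steps are
  independent of them.
\<close>

lemma prob_hit_past_determined:
  assumes "u \<le> y" "y \<le> n" and bound: "\<And>z. walk_kernel d N (y - u) z \<le> B"
    and g: "\<And>xs. g xs \<in> torus d N"
  shows "measure_pmf.prob (step_lists d n) {xs. list_walk d N b xs y = g (take u xs)} \<le> B"
proof -
  let ?p = "pmf_of_set (unit_steps d)"
  define z where "z xs i = g xs i - b i - (\<Sum>s\<leftarrow>xs. s i)" for xs i
  define \<Psi> where "\<Psi> xs ys \<longleftrightarrow> (\<forall>i<d. int N dvd (\<Sum>s\<leftarrow>take (y - u) ys. s i) - z xs i)" for xs ys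
  have eq: "list_walk d N b xs y = g (take u xs) \<longleftrightarrow> \<Psi> (take u xs) (drop u xs)" for xs
  proof -
    have "take y xs = take u xs @ take (y - u) (drop u xs)"
      using assms by (metis le_add_diff_inverse take_add)
    then have "(\<Sum>s\<leftarrow>take y xs. s i) = (\<Sum>s\<leftarrow>take u xs. s i) + (\<Sum>s\<leftarrow>take (y - u) (drop u xs). s i)" for i
      by simp
    then show ?thesis
      unfolding list_walk_def \<Psi>_def z_def
      by (subst torus_proj_torus[OF g, symmetric]) (simp add: torus_proj_eq_iff algebra_simps)
  qed
  have "measure_pmf.prob (replicate_pmf (n - u) ?p) {ys. \<Psi> xs ys} \<le> B" for xs
    using prob_slice_replicate_pmf[of 0 "y - u" "n - u" ?p
        "\<lambda>ys. \<forall>i<d. int N dvd (\<Sum>s\<leftarrow>ys. s i) - z xs i"] bound[of "z xs"] assms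
    by (simp add: \<Psi>_def walk_kernel_def)
  then have "measure_pmf.prob (pair_pmf (replicate_pmf u ?p) (replicate_pmf (n - u) ?p)) {(xs, ys). \<Psi> xs ys} \<le> B"
    by (rule prob_pair_pmf_le)
  then show ?thesis
    unfolding eq using prob_split_replicate_pmf[of u n ?p \<Psi>] assms by simp
qed

lemma walk_kernel_0: "walk_kernel d N 0 z = (if \<forall>i<d. int N dvd z i then 1 else 0)"
  by (simp add: walk_kernel_def measure_return_pmf indicator_def)

lemma sum_unit_steps:
  assumes "\<And>i. i < d \<Longrightarrow> F i (-1) = f (\<lambda>j. if j = i then -1 else 0)" "\<And>i. i < d \<Longrightarrow> F i 1 = f (\<lambda>j. if j = i then 1 else 0)"
  shows "(\<Sum>s\<in>unit_steps d. f s) = (\<Sum>i<d. F i (-1) + F i (1::int) :: real)"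
proof -
  let ?e = "\<lambda>(i::nat, s::int) j. if j = i then s else 0"
  have U: "unit_steps d = ?e ` ({..<d} \<times> {-1, 1})"
    unfolding unit_steps_def by (auto simp: image_def)
  have inj: "inj_on ?e ({..<d} \<times> {-1, 1})"
  proof (rule inj_onI)
    fix p q assume p: "p \<in> {..<d} \<times> {-1, 1::int}" and q: "q \<in> {..<d} \<times> {-1, 1::int}" and "?e p = ?e q"
    then have "\<And>j. ?e p j = ?e q j" by simp
    from this[of "fst p"] show "p = q" using p q by (auto split: prod.splits if_splits)
  qed
  have "(\<Sum>s\<in>unit_steps d. f s) = (\<Sum>p\<in>{..<d} \<times> {-1, 1}. f (?e p))"
    unfolding U by (simp add: sum.reindex[OF inj])
  also have "\<dots> = (\<Sum>i<d. \<Sum>s\<in>{-1, 1}. f (?e (i, s)))" by (subst sum.cartesian_product, intro sum.cong refl) auto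
  also have "\<dots> = (\<Sum>i<d. F i (-1) + F i 1)"
    using assms by (intro sum.cong) auto
  finally show ?thesis .
qed

lemma card_unit_steps: "card (unit_steps d) = 2 * d"
proof -
  have "real (card (unit_steps d)) = (\<Sum>s\<in>unit_steps d. 1)" by simp
  also have "\<dots> = real (2 * d)"
    by (subst sum_unit_steps[where F = "\<lambda>_ _. 1"]) simp_all
  finally show ?thesis by (simp only: of_nat_eq_iff)
qed

lemma walk_kernel_Suc:
  assumes "d > 0"
  shows "walk_kernel d N (Suc k) z = (\<Sum>s\<in>unit_steps d. walk_kernel d N k (\<lambda>i. z i - s i)) / (2 * real d)"
proof -
  let ?p = "pmf_of_set (unit_steps d)"
  have "replicate_pmf (Suc k) ?p = bind_pmf ?p (\<lambda>x. map_pmf ((#) x) (step_lists d k))"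
    by (simp add: map_pmf_def)
  then have "walk_kernel d N (Suc k) z
      = measure_pmf.expectation ?p (\<lambda>s. walk_kernel d N k (\<lambda>i. z i - s i))"
    unfolding walk_kernel_def prob_bind_pmf by (simp add: prob_bind_pmf vimage_def algebra_simps)
  then show ?thesis
    using assms unit_steps_nonempty[of d] finite_unit_steps[of d]
    by (simp add: integral_pmf_of_set card_unit_steps)
qed

section \<open>Fourier analysis and the heat kernel on the torus\<close>

text \<open>
  The characteristic function of a single step at the frequency \<open>2 * pi * \<xi> / N\<close>, which is the eigenvalue of the walk
  at the corresponding character of the torus.
\<close>

definition char_fun :: "nat \<Rightarrow> nat \<Rightarrow> (nat \<Rightarrow> int) \<Rightarrow> real" where
  "char_fun d N \<xi> = (\<Sum>i<d. cos (2 * pi * real_of_int (\<xi> i) / real N)) / real d"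

lemma sum_roots_of_unity:
  assumes "N > 0"
  shows "(\<Sum>j\<in>{0..<int N}. cis (2 * pi * real_of_int (j * z) / real N)) = (if int N dvd z then of_nat N else 0)"
proof -
  define w where "w = cis (2 * pi * real_of_int z / real N)"
  have "(\<Sum>j\<in>{0..<int N}. cis (2 * pi * real_of_int (j * z) / real N)) = (\<Sum>j\<in>int ` {0..<N}. cis (2 * pi * real_of_int (j * z) / real N))"
    by (simp add: image_int_atLeastLessThan)
  also have "\<dots> = (\<Sum>j<N. w ^ j)"
  proof -
    have "cis (2 * pi * real_of_int (int n * z) / real N) = w ^ n" for n
      unfolding w_def Complex.DeMoivre by (simp add: mult_ac)
    then show ?thesis by (subst sum.reindex) (simp_all add: atLeast0LessThan o_def)
  qed
  also have "\<dots> = (if int N dvd z then of_nat N else 0)"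
  proof (cases "int N dvd z")
    case True
    then obtain q where "z = int N * q" by blast
    then have "w = cis (2 * pi * real_of_int q)" using assms by (simp add: w_def field_simps)
    then have "w = 1" by (simp add: cis_multiple_2pi)
    then show ?thesis using True by simp
  next
    case False
    have "w \<noteq> 1"
    proof
      assume "w = 1"
      then have "cos (2 * pi * real_of_int z / real N) = 1" by (auto simp: w_def complex_eq_iff)
      then obtain q :: int where "2 * pi * real_of_int z / real N = real_of_int q * 2 * pi"
        using cos_one_2pi_int by blast
      then have "real_of_int z = real_of_int (q * int N)" using assms by (simp add: field_simps)
      then have "z = q * int N" by (simp only: of_int_eq_iff)
      then show False using False by simp
    qed
    moreover have "w ^ N = 1"
    proof -
      have "w ^ N = cis (2 * pi * real_of_int z)" using assms by (simp add: w_def Complex.DeMoivre)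
      then show ?thesis by (simp add: cis_multiple_2pi)
    qed
    ultimately show ?thesis using False by (simp add: geometric_sum)
  qed
  finally show ?thesis .
qed

lemma cis_sum: "finite A \<Longrightarrow> cis (\<Sum>i\<in>A. f i) = (\<Prod>i\<in>A. cis (f i))"
  by (induction A rule: finite_induct) (auto simp: cis_mult[symmetric])

lemma sum_torus_prod:
  fixes f :: "nat \<Rightarrow> int \<Rightarrow> 'a :: comm_semiring_1"
  shows "(\<Sum>\<xi>\<in>torus d N. \<Prod>i<d. f i (\<xi> i)) = (\<Prod>i<d. \<Sum>j\<in>{0..<int N}. f i j)"
  unfolding torus_def by (rule prod_sum_PiE[symmetric]) auto

text \<open>
  Both sides satisfy the recursion over the first step, because a character is an eigenfunction of the averaging over unit
  steps. For \<open>k = 0\<close> the identity is the orthogonality of characters.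
\<close>

lemma walk_kernel_fourier:
  assumes "d > 0" "N > 0"
  shows "walk_kernel d N k z = (\<Sum>\<xi>\<in>torus d N. char_fun d N \<xi> ^ k
      * cos (2 * pi * real_of_int (\<Sum>i<d. \<xi> i * z i) / real N)) / real N ^ d"
proof (induction k arbitrary: z)
  case 0
  have cis: "cis (2 * pi * real_of_int (\<Sum>i<d. \<xi> i * z i) / real N)
    = (\<Prod>i<d. cis (2 * pi * real_of_int (\<xi> i * z i) / real N))" for \<xi>
    by (simp add: cis_sum[symmetric] sum_distrib_left sum_divide_distrib)
  have "(\<Sum>\<xi>\<in>torus d N. cos (2 * pi * real_of_int (\<Sum>i<d. \<xi> i * z i) / real N))
    = Re (\<Sum>\<xi>\<in>torus d N. cis (2 * pi * real_of_int (\<Sum>i<d. \<xi> i * z i) / real N))" by simp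
  also have "\<dots> = Re (\<Prod>i<d. \<Sum>j\<in>{0..<int N}. cis (2 * pi * real_of_int (j * z i) / real N))"
    unfolding cis sum_torus_prod[where f = "\<lambda>i j. cis (2 * pi * real_of_int (j * z i) / real N)"] ..
  also have "\<dots> = (if \<forall>i<d. int N dvd z i then real N ^ d else 0)"
  proof (cases "\<forall>i<d. int N dvd z i")
    case True
    then show ?thesis unfolding sum_roots_of_unity[OF assms(2)]
      by (simp flip: of_nat_power)
  next
    case False
    then have "(\<Prod>i<d. if int N dvd z i then of_nat N else 0 :: complex) = 0" by (intro prod_zero) auto
    then show ?thesis using False unfolding sum_roots_of_unity[OF assms(2)] by (simp only: if_False zero_complex.sel)
  qed
  finally show ?case using assms by (simp add: walk_kernel_0)
next
  case (Suc k)
  define a where "a \<xi> z = 2 * pi * real_of_int (\<Sum>i<d. \<xi> i * z i) / real N" for \<xi> z :: "nat \<Rightarrow> int"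
  have step: "(\<Sum>s\<in>unit_steps d. cos (a \<xi> (\<lambda>i. z i - s i))) = 2 * real d * char_fun d N \<xi> * cos (a \<xi> z)" for \<xi>
  proof -
    let ?\<theta> = "\<lambda>i. 2 * pi * real_of_int (\<xi> i) / real N"
    have ang: "a \<xi> (\<lambda>j. z j - (if j = i then s else 0)) = a \<xi> z - real_of_int s * ?\<theta> i" if "i < d" for i s
    proof -
      have "(\<Sum>j<d. \<xi> j * (z j - (if j = i then s else 0))) = (\<Sum>j<d. \<xi> j * z j) - (\<Sum>j<d. if j = i then \<xi> j * s else 0)"
        unfolding sum_subtractf[symmetric] by (intro sum.cong) (auto simp: algebra_simps)
      also have "\<dots> = (\<Sum>j<d. \<xi> j * z j) - \<xi> i * s" using that by (simp add: sum.delta)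
      finally have e: "(\<Sum>j<d. \<xi> j * (z j - (if j = i then s else 0))) = (\<Sum>j<d. \<xi> j * z j) - \<xi> i * s" .
      show ?thesis unfolding a_def e by (simp add: right_diff_distrib diff_divide_distrib mult_ac)
    qed
    have "(\<Sum>s\<in>unit_steps d. cos (a \<xi> (\<lambda>i. z i - s i)))
      = (\<Sum>i<d. cos (a \<xi> z - real_of_int (-1) * ?\<theta> i) + cos (a \<xi> z - real_of_int 1 * ?\<theta> i))"
      by (rule sum_unit_steps[where F = "\<lambda>i s. cos (a \<xi> z - real_of_int s * ?\<theta> i)"]) (simp_all only: ang)
    also have "\<dots> = (\<Sum>i<d. 2 * cos (a \<xi> z) * cos (?\<theta> i))"
      by (intro sum.cong) (auto simp: cos_add cos_diff)
    also have "\<dots> = 2 * real d * char_fun d N \<xi> * cos (a \<xi> z)"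
      using assms(1) by (simp add: char_fun_def sum_distrib_left[symmetric])
    finally show ?thesis .
  qed
  have "walk_kernel d N (Suc k) z = (\<Sum>s\<in>unit_steps d. (\<Sum>\<xi>\<in>torus d N. char_fun d N \<xi> ^ k
      * cos (a \<xi> (\<lambda>i. z i - s i))) / real N ^ d) / (2 * real d)"
    unfolding walk_kernel_Suc[OF assms(1)] Suc.IH a_def ..
  also have "\<dots> = (\<Sum>\<xi>\<in>torus d N. char_fun d N \<xi> ^ k * (\<Sum>s\<in>unit_steps d. cos (a \<xi> (\<lambda>i. z i - s i)))) / real N ^ d / (2 * real d)"
    unfolding sum_divide_distrib[symmetric] sum_distrib_left by (subst sum.swap) simp
  also have "\<dots> = (\<Sum>\<xi>\<in>torus d N. char_fun d N \<xi> ^ Suc k * cos (a \<xi> z)) / real N ^ d"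
    unfolding step using assms by (simp add: sum_divide_distrib algebra_simps)
  finally show ?case unfolding a_def .
qed

text \<open>
  The absolute values absorb the parity of the walk: for even \<open>N\<close> the torus is bipartite and the eigenvalue \<open>-1\<close>
  occurs.
\<close>

definition abs_fourier_mean :: "nat \<Rightarrow> nat \<Rightarrow> nat \<Rightarrow> real" where
  "abs_fourier_mean d N k = (\<Sum>\<xi>\<in>torus d N. \<bar>char_fun d N \<xi>\<bar> ^ k) / real N ^ d"

lemma walk_kernel_le_abs_fourier_mean:
  assumes "d > 0" "N > 0"
  shows "walk_kernel d N k z \<le> abs_fourier_mean d N k"
  unfolding walk_kernel_fourier[OF assms] abs_fourier_mean_def
proof (intro divide_right_mono sum_mono)
  fix \<xi>
  let ?c = "cos (2 * pi * real_of_int (\<Sum>i<d. \<xi> i * z i) / real N)"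
  have "char_fun d N \<xi> ^ k * ?c \<le> \<bar>char_fun d N \<xi> ^ k * ?c\<bar>" by simp
  also have "\<dots> \<le> \<bar>char_fun d N \<xi>\<bar> ^ k * 1"
    unfolding abs_mult power_abs by (intro mult_left_mono) auto
  finally show "char_fun d N \<xi> ^ k * ?c \<le> \<bar>char_fun d N \<xi>\<bar> ^ k" by simp
qed simp

text \<open>
  Follows from \<open>sin y = 2 * sin (y/2) * cos (y/2)\<close>, \<open>tan x \<ge> x\<close> and \<open>(cos (y/2))^2 \<ge> 1/2\<close>.
\<close>

lemma half_le_sin:
  assumes "0 \<le> y" "y \<le> pi / 2"
  shows "y / 2 \<le> sin y"
proof -
  have y: "0 \<le> y/2" "y/2 \<le> pi/4" using assms by auto
  have c: "sqrt 2 / 2 \<le> cos (y/2)"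
    using cos_monotone_0_pi_le[of "y/2" "pi/4"] y by (simp add: cos_45)
  then have c0: "cos (y/2) > 0" by (smt (verit) divide_pos_pos real_sqrt_gt_0_iff)
  have "(sqrt 2 / 2)^2 \<le> cos (y/2)^2" using c by (intro power_mono) auto
  then have c2: "1/2 \<le> cos (y/2)^2" by (simp add: power_divide)
  have "\<bar>y/2\<bar> \<le> \<bar>tan (y/2)\<bar>" using y pi_gt_zero by (intro abs_tan_ge) linarith
  moreover have "0 \<le> tan (y/2)" using y c0 pi_gt_zero assms
    by (auto simp: tan_def intro!: divide_nonneg_pos sin_ge_zero)
  ultimately have "y/2 \<le> tan (y/2)" using y by linarith
  then have "y/2 \<le> sin (y/2) / cos (y/2)" by (simp add: tan_def)
  then have "y/2 * cos (y/2) \<le> sin (y/2)" using c0 by (simp add: field_simps)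
  then have "y/2 * cos (y/2) * cos (y/2) \<le> sin (y/2) * cos (y/2)" using c0 by (intro mult_right_mono) auto
  then have "y * cos (y/2)^2 \<le> sin y"
    using sin_double[of "y/2"] by (simp add: power2_eq_square algebra_simps)
  moreover have "y * (1/2) \<le> y * cos (y/2)^2" using c2 assms by (intro mult_left_mono) auto
  ultimately show ?thesis by simp
qed

text \<open>
  By \<open>exp (- x) \<le> 1 / (1 + x)\<close>, the terms with \<open>l > 0\<close> are dominated by increments of
  \<open>arctan (sqrt \<kappa> * l) / sqrt \<kappa>\<close>.
\<close>

lemma sum_gaussian_nat_le:
  assumes "\<kappa> > 0"
  shows "(\<Sum>l\<le>n. exp (- \<kappa> * real l ^ 2)) \<le> 1 + 2 / sqrt \<kappa>"
proof -
  have step: "exp (- \<kappa> * real (Suc l) ^ 2) \<le> (arctan (sqrt \<kappa> * real (Suc l)) - arctan (sqrt \<kappa> * real l)) / sqrt \<kappa>" for l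
  proof -
    let ?a = "sqrt \<kappa> * real l" and ?b = "sqrt \<kappa> * real (Suc l)"
    have ab: "?a < ?b" using assms by simp
    obtain c where c: "?a < c" "c < ?b" "arctan ?b - arctan ?a = (?b - ?a) * inverse (1 + c^2)"
      using MVT2[OF ab, of arctan "\<lambda>x. inverse (1 + x^2)"] DERIV_arctan by auto
    have "0 \<le> ?a" using assms by simp
    then have "0 \<le> c" using c by linarith
    then have "c^2 \<le> ?b^2" using c by (intro power_mono) auto
    also have "?b^2 = \<kappa> * real (Suc l)^2" using assms by (simp add: power_mult_distrib)
    finally have "1 + c^2 \<le> 1 + \<kappa> * real (Suc l)^2" by simp
    also have "\<dots> \<le> exp (\<kappa> * real (Suc l)^2)" by (rule exp_ge_add_one_self)
    finally have "inverse (exp (\<kappa> * real (Suc l)^2)) \<le> inverse (1 + c^2)"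
      by (intro le_imp_inverse_le) (auto simp: add_pos_nonneg)
    then have "exp (- \<kappa> * real (Suc l)^2) \<le> inverse (1 + c^2)" by (simp add: exp_minus)
    also have "\<dots> = (arctan ?b - arctan ?a) / sqrt \<kappa>"
      unfolding c(3) using assms by (simp add: right_diff_distrib[symmetric])
    finally show ?thesis .
  qed
  have "(\<Sum>l\<le>n. exp (- \<kappa> * real l ^ 2)) \<le> 1 + arctan (sqrt \<kappa> * real n) / sqrt \<kappa>"
  proof (induction n)
    case (Suc n)
    then show ?case using step[of n] by (simp add: diff_divide_distrib)
  qed simp
  also have "arctan (sqrt \<kappa> * real n) \<le> 2"
    using arctan_ubound[of "sqrt \<kappa> * real n"] pi_less_4 by simp
  finally show ?thesis using assms by (simp add: divide_right_mono)
qed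

lemma sum_gaussian_int_le:
  fixes A :: "int set"
  assumes "\<kappa> > 0" "finite A"
  shows "(\<Sum>j\<in>A. exp (- \<kappa> * (real_of_int j - y)^2)) \<le> 2 + 4 / sqrt \<kappa>"
proof -
  have side: "(\<Sum>j\<in>B. exp (- \<kappa> * (real_of_int j - y)^2)) \<le> 1 + 2 / sqrt \<kappa>"
    if "finite B" "inj_on m B" "\<And>j. j \<in> B \<Longrightarrow> real (m j) \<le> \<bar>real_of_int j - y\<bar>" for B :: "int set" and m
  proof -
    have "(\<Sum>j\<in>B. exp (- \<kappa> * (real_of_int j - y)^2)) \<le> (\<Sum>j\<in>B. exp (- \<kappa> * real (m j)^2))"
    proof (intro sum_mono)
      fix j assume "j \<in> B"
      then have "real (m j)^2 \<le> \<bar>real_of_int j - y\<bar>^2" using that by (intro power_mono) auto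
      then show "exp (- \<kappa> * (real_of_int j - y)^2) \<le> exp (- \<kappa> * real (m j)^2)"
        using assms by simp
    qed
    also have "\<dots> = (\<Sum>l\<in>m ` B. exp (- \<kappa> * real l^2))" by (simp add: sum.reindex[OF that(2)])
    also have "\<dots> \<le> (\<Sum>l\<le>Max (m ` B). exp (- \<kappa> * real l^2))"
      using that by (intro sum_mono2) auto
    also have "\<dots> \<le> 1 + 2 / sqrt \<kappa>" by (rule sum_gaussian_nat_le[OF assms(1)])
    finally show ?thesis .
  qed
  have "(\<Sum>j\<in>A. exp (- \<kappa> * (real_of_int j - y)^2)) = (\<Sum>j\<in>{j\<in>A. y \<le> real_of_int j}. exp (- \<kappa> * (real_of_int j - y)^2))
     + (\<Sum>j\<in>{j\<in>A. real_of_int j < y}. exp (- \<kappa> * (real_of_int j - y)^2))"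
    using assms(2) by (subst sum.union_disjoint[symmetric]) (auto intro!: sum.cong)
  also have "\<dots> \<le> (1 + 2 / sqrt \<kappa>) + (1 + 2 / sqrt \<kappa>)"
  proof (intro add_mono)
    show "(\<Sum>j\<in>{j\<in>A. y \<le> real_of_int j}. exp (- \<kappa> * (real_of_int j - y)^2)) \<le> 1 + 2 / sqrt \<kappa>"
    proof (rule side[where m = "\<lambda>j. nat (j - \<lceil>y\<rceil>)"])
      fix j assume j: "j \<in> {j\<in>A. y \<le> real_of_int j}"
      then have "\<lceil>y\<rceil> \<le> j" by (simp add: ceiling_le_iff)
      then show "real (nat (j - \<lceil>y\<rceil>)) \<le> \<bar>real_of_int j - y\<bar>" using j le_of_int_ceiling[of y] by (simp del: le_of_int_ceiling)
    qed (use assms(2) in \<open>auto simp: inj_on_def ceiling_le_iff eq_nat_nat_iff\<close>)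
    show "(\<Sum>j\<in>{j\<in>A. real_of_int j < y}. exp (- \<kappa> * (real_of_int j - y)^2)) \<le> 1 + 2 / sqrt \<kappa>"
    proof (rule side[where m = "\<lambda>j. nat (\<lfloor>y\<rfloor> - j)"])
      fix j assume j: "j \<in> {j\<in>A. real_of_int j < y}"
      then have "j \<le> \<lfloor>y\<rfloor>" by (simp add: le_floor_iff)
      then show "real (nat (\<lfloor>y\<rfloor> - j)) \<le> \<bar>real_of_int j - y\<bar>" using j of_int_floor_le[of y] by (simp del: of_int_floor_le)
    next
      show "inj_on (\<lambda>j. nat (\<lfloor>y\<rfloor> - j)) {j\<in>A. real_of_int j < y}"
        by (rule inj_onI) (smt (verit) le_floor_iff eq_nat_nat_iff mem_Collect_eq)
    qed (use assms(2) in simp)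
  qed
  finally show ?thesis by simp
qed

text \<open>
  On \<open>{0..1}\<close> the function \<open>sin (2 * pi * x)\<close> vanishes only at 0, 1/2 and 1, and to first order there.
\<close>

lemma sin_sq_ge_dist_sq:
  assumes "0 \<le> x" "x \<le> 1"
  shows "\<exists>c\<in>{0, 1/2, 1}. 4 * (x - c)^2 \<le> (sin (2 * pi * x))^2"
proof -
  have core: "4 * t^2 \<le> (sin (2 * pi * t))^2" if "\<bar>t\<bar> \<le> 1/4" for t
  proof -
    have "2 * pi * \<bar>t\<bar> / 2 \<le> sin (2 * pi * \<bar>t\<bar>)"
      using that pi_gt_zero by (intro half_le_sin) (auto simp: field_simps)
    moreover have "2 * \<bar>t\<bar> \<le> 2 * pi * \<bar>t\<bar> / 2" using pi_gt3 by (simp add: mult_right_mono)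
    ultimately have "(2 * \<bar>t\<bar>)^2 \<le> (sin (2 * pi * \<bar>t\<bar>))^2" by (intro power_mono) linarith+
    then show ?thesis by (cases "t \<ge> 0") (auto simp: power_mult_distrib abs_if)
  qed
  have s1: "(sin (2 * pi * (x - 1/2)))^2 = (sin (2 * pi * x))^2"
    by (simp add: right_diff_distrib sin_diff)
  have s2: "(sin (2 * pi * (x - 1)))^2 = (sin (2 * pi * x))^2"
    by (simp add: right_diff_distrib sin_diff)
  consider "x \<le> 1/4" | "\<bar>x - 1/2\<bar> \<le> 1/4" | "\<bar>x - 1\<bar> \<le> 1/4"
    using assms by argo
  then show ?thesis
  proof cases
    case 1 then show ?thesis using core[of x] assms by auto
  next
    case 2 then show ?thesis using core[of "x - 1/2"] s1 by auto
  next
    case 3 then show ?thesis using core[of "x - 1"] s2 by auto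
  qed
qed

lemma abs_cos_le: "\<bar>cos x\<bar> \<le> 1 - (sin x)^2 / 2" for x :: real
proof (rule power2_le_imp_le)
  have "(1 - (sin x)^2 / 2)^2 = (cos x)^2 + ((sin x)^2 / 2)^2"
    unfolding cos_squared_eq by (simp add: power2_eq_square field_simps)
  then show "\<bar>cos x\<bar>^2 \<le> (1 - (sin x)^2 / 2)^2" by simp
  have "(sin x)^2 \<le> 1" by (simp add: abs_square_le_1)
  then show "0 \<le> 1 - (sin x)^2 / 2" by simp
qed

text \<open>
  A Gaussian bound that factorises over the coordinates, so that the sum over frequencies becomes a power of a
  one-dimensional sum.
\<close>

lemma abs_char_fun_power_le:
  assumes "d > 0"
  shows "\<bar>char_fun d N \<xi>\<bar> ^ k
    \<le> (\<Prod>i<d. exp (- (real k / (2 * real d)) * (sin (2 * pi * (real_of_int (\<xi> i) / real N)))^2))"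
proof -
  let ?s = "\<lambda>i. (sin (2 * pi * (real_of_int (\<xi> i) / real N)))^2"
  have "\<bar>char_fun d N \<xi>\<bar> \<le> (\<Sum>i<d. \<bar>cos (2 * pi * (real_of_int (\<xi> i) / real N))\<bar>) / real d"
    unfolding char_fun_def abs_divide by (simp add: divide_right_mono sum_abs)
  also have "\<dots> \<le> (\<Sum>i<d. 1 - ?s i / 2) / real d"
    by (intro divide_right_mono sum_mono abs_cos_le) auto
  also have "\<dots> = 1 + - (\<Sum>i<d. ?s i) / (2 * real d)"
    using assms by (simp add: sum_subtractf sum_divide_distrib[symmetric] field_simps)
  also have "\<dots> \<le> exp (- (\<Sum>i<d. ?s i) / (2 * real d))" by (rule exp_ge_add_one_self)
  finally have "\<bar>char_fun d N \<xi>\<bar> ^ k \<le> exp (- (\<Sum>i<d. ?s i) / (2 * real d)) ^ k"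
    by (intro power_mono) auto
  also have "\<dots> = exp (\<Sum>i<d. - (real k / (2 * real d)) * ?s i)"
    by (simp add: exp_of_nat_mult[symmetric] sum_distrib_left sum_negf sum_divide_distrib)
  also have "\<dots> = (\<Prod>i<d. exp (- (real k / (2 * real d)) * ?s i))" by (simp add: exp_sum)
  finally show ?thesis .
qed

lemma mean_exp_sin_sq_le:
  assumes "d > 0" "N > 0" "k > 0"
  shows "(\<Sum>j\<in>{0..<int N}. exp (- (real k / (2 * real d)) * (sin (2 * pi * (real_of_int j / real N)))^2)) / real N
    \<le> 12 * real d * (1 / sqrt (real k) + 1 / real N)"
proof -
  define \<kappa> where "\<kappa> = 2 * real k / (real d * real N ^ 2)"
  have \<kappa>: "\<kappa> > 0" using assms by (simp add: \<kappa>_def)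
  have "exp (- (real k / (2 * real d)) * (sin (2 * pi * (real_of_int j / real N)))^2)
      \<le> (\<Sum>c\<in>{0, 1/2, 1}. exp (- \<kappa> * (real_of_int j - c * real N)^2))" (is "?l j \<le> ?r j")
    if j: "j \<in> {0..<int N}" for j
  proof -
    have "0 \<le> real_of_int j / real N" "real_of_int j / real N \<le> 1" using j assms by auto
    from sin_sq_ge_dist_sq[OF this] obtain c where c: "c \<in> {0, 1/2, 1}"
      "4 * (real_of_int j / real N - c)^2 \<le> (sin (2 * pi * (real_of_int j / real N)))^2" by blast
    have "\<kappa> * (real_of_int j - c * real N)^2 = (real k / (2 * real d)) * (4 * (real_of_int j / real N - c)^2)"
      using assms by (simp add: \<kappa>_def field_simps power2_eq_square)
    also have "\<dots> \<le> (real k / (2 * real d)) * (sin (2 * pi * (real_of_int j / real N)))^2"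
      using c by (intro mult_left_mono) auto
    finally have "?l j \<le> exp (- \<kappa> * (real_of_int j - c * real N)^2)" by simp
    also have "\<dots> \<le> ?r j" using c(1) by (intro member_le_sum) auto
    finally show ?thesis .
  qed
  then have "(\<Sum>j\<in>{0..<int N}. ?l j) \<le> (\<Sum>j\<in>{0..<int N}. ?r j)" by (rule sum_mono)
  also have "\<dots> = (\<Sum>c\<in>{0, 1/2, 1}. \<Sum>j\<in>{0..<int N}. exp (- \<kappa> * (real_of_int j - c * real N)^2))"
    by (rule sum.swap)
  also have "\<dots> \<le> (\<Sum>c\<in>{0, 1/2, 1::real}. 2 + 4 / sqrt \<kappa>)"
    by (intro sum_mono sum_gaussian_int_le \<kappa>) auto
  also have "\<dots> = 6 + 12 / sqrt \<kappa>" by simp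
  also have "1 / sqrt \<kappa> \<le> real d * real N / sqrt (real k)"
  proof -
    have "1 / sqrt \<kappa> = sqrt (real d / 2) * real N / sqrt (real k)"
      using assms by (simp add: \<kappa>_def real_sqrt_divide real_sqrt_mult)
    also have "sqrt (real d / 2) \<le> real d"
    proof (rule real_le_lsqrt)
      have "real d \<le> real d ^ 2" using assms by (simp add: power2_eq_square)
      then show "real d / 2 \<le> (real d)^2" using assms by linarith
    qed auto
    finally show ?thesis by (simp add: divide_right_mono mult_right_mono)
  qed
  then have "6 + 12 / sqrt \<kappa> \<le> 6 + 12 * (real d * real N / sqrt (real k))" by simp
  finally have "(\<Sum>j\<in>{0..<int N}. ?l j) / real N \<le> (6 + 12 * (real d * real N / sqrt (real k))) / real N"
    by (rule divide_right_mono) simp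
  also have "\<dots> = 6 / real N + 12 * real d / sqrt (real k)" using assms by (simp add: field_simps)
  also have "6 / real N \<le> 12 * real d / real N" using assms by (intro divide_right_mono) auto
  finally show ?thesis by (simp add: algebra_simps)
qed

lemma abs_fourier_mean_le:
  assumes "d > 0" "N > 0" "k > 0"
  shows "abs_fourier_mean d N k \<le> (12 * real d * (1 / sqrt (real k) + 1 / real N)) ^ d"
proof -
  let ?g = "\<lambda>j. exp (- (real k / (2 * real d)) * (sin (2 * pi * (real_of_int j / real N)))^2)"
  have "(\<Sum>\<xi>\<in>torus d N. \<bar>char_fun d N \<xi>\<bar> ^ k) \<le> (\<Sum>\<xi>\<in>torus d N. \<Prod>i<d. ?g (\<xi> i))"
    by (intro sum_mono abs_char_fun_power_le assms)
  also have "\<dots> = (\<Sum>j\<in>{0..<int N}. ?g j) ^ d"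
    unfolding sum_torus_prod[where f = "\<lambda>i. ?g"] by simp
  finally have "abs_fourier_mean d N k \<le> (\<Sum>j\<in>{0..<int N}. ?g j) ^ d / real N ^ d"
    unfolding abs_fourier_mean_def by (rule divide_right_mono) simp
  also have "\<dots> = ((\<Sum>j\<in>{0..<int N}. ?g j) / real N) ^ d" by (simp add: power_divide)
  also have "\<dots> \<le> (12 * real d * (1 / sqrt (real k) + 1 / real N)) ^ d"
    by (intro power_mono mean_exp_sin_sq_le assms divide_nonneg_nonneg sum_nonneg) auto
  finally show ?thesis .
qed

text \<open>
  From time \<open>N^2\<close> on, the transition probabilities are at most a constant multiple of the uniform ones.
\<close>

lemma abs_fourier_mean_le_equilibrium:
  assumes "d > 0" "N > 0" "N^2 \<le> k"
  shows "abs_fourier_mean d N k \<le> (24 * real d) ^ d / real N ^ d"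
proof -
  have "real N \<le> sqrt (real k)" using assms by (intro real_le_rsqrt) (simp flip: of_nat_power)
  moreover have k: "k > 0" using assms by (cases k) auto
  ultimately have "1 / sqrt (real k) \<le> 1 / real N" using assms by (intro divide_left_mono) auto
  then have "12 * real d * (1 / sqrt (real k) + 1 / real N) \<le> 12 * real d * (2 / real N)"
    by (intro mult_left_mono) auto
  then have le: "12 * real d * (1 / sqrt (real k) + 1 / real N) \<le> 24 * real d / real N" by simp
  have "abs_fourier_mean d N k \<le> (12 * real d * (1 / sqrt (real k) + 1 / real N)) ^ d"
    using assms k by (intro abs_fourier_mean_le) auto
  also have "\<dots> \<le> (24 * real d / real N) ^ d" using le by (intro power_mono) auto
  finally show ?thesis by (simp add: power_divide)
qed

text \<open>
  The exponent 5 stands for \<open>d\<close> when \<open>d \<ge> 5\<close>: the decay \<open>k^(-5/2)\<close> is all that the estimates on loops use,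
  and it makes their constants uniform.
\<close>

lemma abs_fourier_mean_le_gaussian_plus_equilibrium:
  assumes "d \<ge> 5" "N > 0" "k > 0"
  shows "abs_fourier_mean d N k \<le> (24 * real d) ^ d * (1 / sqrt (real k) ^ 5 + 1 / real N ^ d)"
proof (cases "N^2 \<le> k")
  case True
  have "abs_fourier_mean d N k \<le> (24 * real d) ^ d * (1 / real N ^ d)"
    using abs_fourier_mean_le_equilibrium[of d N k] assms True by simp
  also have "\<dots> \<le> (24 * real d) ^ d * (1 / sqrt (real k) ^ 5 + 1 / real N ^ d)"
    by (intro mult_left_mono) auto
  finally show ?thesis .
next
  case False
  have k1: "1 \<le> sqrt (real k)" using assms by simp
  have "sqrt (real k) \<le> real N" using False by (intro real_le_lsqrt) (auto simp flip: of_nat_power)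
  then have "1 / real N \<le> 1 / sqrt (real k)" using assms by (intro divide_left_mono) auto
  then have "12 * real d * (1 / sqrt (real k) + 1 / real N) \<le> 12 * real d * (2 / sqrt (real k))"
    by (intro mult_left_mono) auto
  then have le: "12 * real d * (1 / sqrt (real k) + 1 / real N) \<le> 24 * real d / sqrt (real k)" by simp
  have "abs_fourier_mean d N k \<le> (12 * real d * (1 / sqrt (real k) + 1 / real N)) ^ d"
    using assms by (intro abs_fourier_mean_le) auto
  also have "\<dots> \<le> (24 * real d / sqrt (real k)) ^ d" using le by (intro power_mono) auto
  also have "\<dots> = (24 * real d) ^ d * (1 / sqrt (real k) ^ d)" by (simp add: power_divide)
  also have "\<dots> \<le> (24 * real d) ^ d * (1 / sqrt (real k) ^ 5)"
    using assms k1 by (intro mult_left_mono divide_left_mono power_increasing) auto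
  also have "\<dots> \<le> (24 * real d) ^ d * (1 / sqrt (real k) ^ 5 + 1 / real N ^ d)"
    by (intro mult_left_mono) auto
  finally show ?thesis .
qed

lemma inverse_sqrt_cube_le_telescope:
  assumes "k > 0"
  shows "1 / sqrt (real k) ^ 3 \<le> 4 * (1 / sqrt (real k) - 1 / sqrt (real (Suc k)))"
proof -
  define a b where "a = sqrt (real k)" and "b = sqrt (real (Suc k))"
  have a: "a \<ge> 1" "a > 0" using assms by (auto simp: a_def)
  have ab: "a \<le> b" by (simp add: a_def b_def)
  have b2: "b^2 = a^2 + 1" by (simp add: a_def b_def)
  have "1 \<le> a^2" using a by simp
  then have "b^2 \<le> (3/2 * a)^2" using b2 by (simp add: power_mult_distrib power2_eq_square)
  then have ba: "b \<le> 3/2 * a" using a by (rule_tac power2_le_imp_le) auto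
  have "b * (a + b) \<le> (3/2 * a) * (a + 3/2 * a)" using a ab ba by (intro mult_mono) auto
  also have "\<dots> \<le> 4 * a^2" by (simp add: power2_eq_square)
  finally have le: "b * (a + b) \<le> 4 * a^2" .
  have "(b - a) * (a + b) = 1" using b2 by (simp add: algebra_simps power2_eq_square)
  then have ba1: "b - a = 1 / (a + b)" using a ab by (simp add: field_simps)
  have "1 / a - 1 / b = (b - a) / (a * b)" using a ab by (simp add: diff_frac_eq)
  also have "\<dots> = 1 / (a * (b * (a + b)))" unfolding ba1 by (simp add: mult_ac)
  also have "1 / (a * (4 * a^2)) \<le> \<dots>" using le a ab by (intro divide_left_mono mult_left_mono mult_pos_pos) auto
  finally have "4 * (1 / (a * (4 * a^2))) \<le> 4 * (1 / a - 1 / b)" by simp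
  then show ?thesis unfolding a_def[symmetric] b_def[symmetric] using a by (simp add: power3_eq_cube power2_eq_square)
qed

lemma sum_inverse_sqrt_cube_le:
  assumes "D > 0"
  shows "(\<Sum>k\<in>{D..<M}. 1 / sqrt (real k) ^ 3) \<le> 4 / sqrt (real D)"
proof (cases "D \<le> M")
  case True
  have "(\<Sum>k\<in>{D..<M}. 1 / sqrt (real k) ^ 3) \<le> (\<Sum>k\<in>{D..<M}. 4 * (1 / sqrt (real k) - 1 / sqrt (real (Suc k))))"
    using assms by (intro sum_mono inverse_sqrt_cube_le_telescope) auto
  also have "\<dots> = 4 * (1 / sqrt (real D) - 1 / sqrt (real M))"
    using sum_Suc_diff'[OF True, of "\<lambda>k. - (1 / sqrt (real k))"]
    unfolding sum_distrib_left[symmetric] by simp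
  also have "\<dots> \<le> 4 / sqrt (real D)" by simp
  finally show ?thesis .
qed (use assms in auto)

lemma sum_inverse_sqrt_le: "(\<Sum>k\<in>{1..n}. 1 / sqrt (real k)) \<le> 2 * sqrt (real n)"
proof (induction n)
  case (Suc n)
  define a b where "a = sqrt (real n)" and "b = sqrt (real (Suc n))"
  have "0 \<le> a" "a \<le> b" "b > 0" "b^2 = a^2 + 1" by (auto simp: a_def b_def)
  then have "1 = (b - a) * (b + a)" by (simp add: algebra_simps power2_eq_square)
  also have "\<dots> \<le> (b - a) * (2 * b)" using \<open>a \<le> b\<close> \<open>0 \<le> a\<close> by (intro mult_left_mono) auto
  finally have "1 / b \<le> 2 * (b - a)" using \<open>b > 0\<close> by (simp add: field_simps)
  then show ?case using Suc.IH unfolding a_def b_def by simp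
qed simp

section \<open>The time to hit a uniform point\<close>

definition torus_origin :: "nat \<Rightarrow> nat \<Rightarrow> int" where
  "torus_origin d = (\<lambda>i\<in>{..<d}. 0)"

lemma torus_origin_in: "N > 0 \<Longrightarrow> torus_origin d \<in> torus d N"
  by (auto simp: torus_origin_def torus_def)

lemma card_torus: "card (torus d N) = N ^ d"
  by (simp add: torus_def card_PiE)

lemma char_fun_origin: "d > 0 \<Longrightarrow> char_fun d N (torus_origin d) = 1"
  by (simp add: char_fun_def torus_origin_def)

lemma abs_char_fun_le_1: "\<bar>char_fun d N \<xi>\<bar> \<le> 1"
proof -
  have "\<bar>\<Sum>i<d. cos (2 * pi * real_of_int (\<xi> i) / real N)\<bar> \<le> (\<Sum>i<d. 1)"
    by (rule order_trans[OF sum_abs]) (intro sum_mono, simp)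
  then show ?thesis by (cases "d = 0") (simp_all add: char_fun_def)
qed

text \<open>
  The spectral gap of the walk, read off from one nonzero coordinate of the frequency.
\<close>

lemma char_fun_gap:
  assumes "d > 0" "N > 0" "\<xi> \<in> torus d N - {torus_origin d}"
  shows "2 / (real d * real N ^ 2) \<le> 1 - char_fun d N \<xi>"
proof -
  let ?c = "\<lambda>i. cos (2 * pi * real_of_int (\<xi> i) / real N)"
  have "\<exists>i<d. \<xi> i \<noteq> 0"
  proof (rule ccontr)
    assume "\<not> ?thesis"
    then have "\<xi> = torus_origin d"
      using assms(3) by (intro ext) (auto simp: torus_origin_def torus_def restrict_def PiE_iff extensional_def)
    then show False using assms by simp
  qed
  then obtain i where i: "i < d" "\<xi> i \<noteq> 0" by blast
  have r: "1 \<le> \<xi> i" "\<xi> i \<le> int N - 1" using assms(3) i by (force simp: torus_def PiE_iff)+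
  define x where "x = real_of_int (\<xi> i) / real N"
  have "real_of_int (\<xi> i) \<le> real_of_int (int N - 1)" using r(2) by (simp only: of_int_le_iff)
  then have x: "1 / real N \<le> x" "1 / real N \<le> 1 - x"
    using assms r by (auto simp: x_def field_simps)
  have x0: "0 \<le> x" "x \<le> 1" using x by (smt (verit) divide_nonneg_nonneg of_nat_0_le_iff)+
  have "1 / real N \<le> sin (pi * x)"
  proof (cases "x \<le> 1/2")
    case True
    then have "pi * x / 2 \<le> sin (pi * x)" using x0 pi_gt_zero by (intro half_le_sin) auto
    moreover have "2 * x \<le> pi * x" using pi_gt3 x0 by (intro mult_right_mono) auto
    ultimately show ?thesis using x by linarith
  next
    case False
    define w where "w = 1 - x"
    have "0 \<le> w" "w \<le> 1/2" using x0 False by (auto simp: w_def)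
    then have "pi * w / 2 \<le> sin (pi * w)" using pi_gt_zero by (intro half_le_sin) auto
    moreover have "2 * w \<le> pi * w" using pi_gt3 \<open>0 \<le> w\<close> by (intro mult_right_mono) auto
    moreover have "sin (pi * w) = sin (pi * x)" by (simp add: w_def right_diff_distrib)
    ultimately show ?thesis using x by (simp add: w_def)
  qed
  then have "(1 / real N)^2 \<le> (sin (pi * x))^2" by (intro power_mono) auto
  moreover have "?c i = 1 - 2 * (sin (pi * x))^2"
    using cos_double_sin[of "pi * x"] by (simp add: x_def mult_ac)
  ultimately have ci: "?c i \<le> 1 - 2 / real N ^ 2" by (simp add: power_divide)
  have "(\<Sum>j<d. ?c j) = ?c i + (\<Sum>j\<in>{..<d} - {i}. ?c j)" using i by (subst sum.remove) auto
  also have "(\<Sum>j\<in>{..<d} - {i}. ?c j) \<le> (\<Sum>j\<in>{..<d} - {i}. 1)" by (intro sum_mono) auto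
  also have "\<dots> = real d - 1" using i by (simp add: of_nat_diff)
  finally have "(\<Sum>j<d. ?c j) \<le> real d - 2 / real N ^ 2" using ci by simp
  then have "char_fun d N \<xi> \<le> (real d - 2 / real N ^ 2) / real d"
    unfolding char_fun_def by (rule divide_right_mono) simp
  also have "\<dots> = 1 - 2 / (real d * real N ^ 2)" using assms by (simp add: field_simps)
  finally show ?thesis by simp
qed

definition green_bound :: "nat \<Rightarrow> real" where
  "green_bound d = 1 + (5 + real d) * (24 * real d) ^ d"

text \<open>
  The geometric series for \<open>1 / (1 - \<phi>)\<close> is stopped at \<open>K = N^2\<close>. The terms before \<open>K\<close> sum to heat kernel bounds,
  which are summable in dimension above 2; the remainder \<open>\<phi>^K / (1 - \<phi>)\<close> is controlled by the spectral gap, whose factor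
  \<open>N^2\<close> is compensated by the equilibrium bound at time \<open>K\<close>.
\<close>

lemma spectral_green_le:
  assumes "d \<ge> 5" "N > 0"
  shows "(\<Sum>\<xi>\<in>torus d N - {torus_origin d}. 1 / (1 - char_fun d N \<xi>)) / real N ^ d \<le> green_bound d"
proof -
  let ?T = "torus d N - {torus_origin d}" and ?\<phi> = "char_fun d N" and ?H = "abs_fourier_mean d N"
  let ?B = "(24 * real d) ^ d"
  define K where "K = N^2"
  have d: "d > 0" using assms by simp
  have N2: "1 / real N ^ d \<le> 1 / real N ^ 2"
    using assms by (intro divide_left_mono power_increasing) auto
  have expand: "1 / (1 - ?\<phi> \<xi>) \<le> (\<Sum>k<K. \<bar>?\<phi> \<xi>\<bar> ^ k) + real d * real K / 2 * \<bar>?\<phi> \<xi>\<bar> ^ K"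
    if "\<xi> \<in> ?T" for \<xi>
  proof -
    have gap: "2 / (real d * real K) \<le> 1 - ?\<phi> \<xi>"
      using char_fun_gap[OF d assms(2) that] by (simp add: K_def)
    have gap0: "0 < 2 / (real d * real K)" using assms by (simp add: K_def)
    have inv: "1 / (1 - ?\<phi> \<xi>) \<le> real d * real K / 2"
      using le_imp_inverse_le[OF gap gap0] by (simp add: inverse_eq_divide)
    have "(\<Sum>k<K. ?\<phi> \<xi> ^ k) = (?\<phi> \<xi> ^ K - 1) / (?\<phi> \<xi> - 1)"
      using gap gap0 by (intro geometric_sum) auto
    also have "\<dots> = (1 - ?\<phi> \<xi> ^ K) / (1 - ?\<phi> \<xi>)" by (metis minus_diff_eq minus_divide_divide)
    finally have "1 / (1 - ?\<phi> \<xi>) = (\<Sum>k<K. ?\<phi> \<xi> ^ k) + ?\<phi> \<xi> ^ K * (1 / (1 - ?\<phi> \<xi>))"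
      by (simp add: diff_divide_distrib)
    also have "\<dots> \<le> (\<Sum>k<K. \<bar>?\<phi> \<xi>\<bar> ^ k) + \<bar>?\<phi> \<xi>\<bar> ^ K * (real d * real K / 2)"
    proof (intro add_mono sum_mono)
      show "?\<phi> \<xi> ^ k \<le> \<bar>?\<phi> \<xi>\<bar> ^ k" for k by (metis abs_ge_self power_abs)
      then have "?\<phi> \<xi> ^ K * (1 / (1 - ?\<phi> \<xi>)) \<le> \<bar>?\<phi> \<xi>\<bar> ^ K * (1 / (1 - ?\<phi> \<xi>))"
        using abs_char_fun_le_1[of d N \<xi>] by (intro mult_right_mono) auto
      also have "\<dots> \<le> \<bar>?\<phi> \<xi>\<bar> ^ K * (real d * real K / 2)" using inv by (intro mult_left_mono) auto
      finally show "?\<phi> \<xi> ^ K * (1 / (1 - ?\<phi> \<xi>)) \<le> \<bar>?\<phi> \<xi>\<bar> ^ K * (real d * real K / 2)" .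
    qed
    finally show ?thesis by (simp add: mult_ac)
  qed
  have "(\<Sum>\<xi>\<in>?T. 1 / (1 - ?\<phi> \<xi>)) \<le> (\<Sum>\<xi>\<in>?T. (\<Sum>k<K. \<bar>?\<phi> \<xi>\<bar> ^ k) + real d * real K / 2 * \<bar>?\<phi> \<xi>\<bar> ^ K)"
    by (intro sum_mono expand)
  also have "\<dots> \<le> (\<Sum>\<xi>\<in>torus d N. (\<Sum>k<K. \<bar>?\<phi> \<xi>\<bar> ^ k) + real d * real K / 2 * \<bar>?\<phi> \<xi>\<bar> ^ K)"
    by (intro sum_mono2 finite_torus add_nonneg_nonneg sum_nonneg) auto
  also have "\<dots> = (\<Sum>k<K. \<Sum>\<xi>\<in>torus d N. \<bar>?\<phi> \<xi>\<bar> ^ k) + real d * real K / 2 * (\<Sum>\<xi>\<in>torus d N. \<bar>?\<phi> \<xi>\<bar> ^ K)"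
    by (simp add: sum.distrib sum_distrib_left sum.swap[of _ "{..<K}"])
  finally have "(\<Sum>\<xi>\<in>?T. 1 / (1 - ?\<phi> \<xi>)) / real N ^ d
    \<le> ((\<Sum>k<K. \<Sum>\<xi>\<in>torus d N. \<bar>?\<phi> \<xi>\<bar> ^ k) + real d * real K / 2 * (\<Sum>\<xi>\<in>torus d N. \<bar>?\<phi> \<xi>\<bar> ^ K)) / real N ^ d"
    by (rule divide_right_mono) simp
  also have "\<dots> = (\<Sum>k<K. ?H k) + real d * real K / 2 * ?H K"
    unfolding abs_fourier_mean_def sum_divide_distrib[symmetric] by (simp add: add_divide_distrib)
  also have "(\<Sum>k<K. ?H k) \<le> 1 + ?B * 5"
  proof -
    have H0: "?H 0 = 1" using assms by (simp add: abs_fourier_mean_def card_torus)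
    have K0: "K > 0" using assms by (simp add: K_def)
    have "(\<Sum>k<K. ?H k) = ?H 0 + (\<Sum>k\<in>{1..<K}. ?H k)"
      using K0 by (simp add: sum.atLeast_Suc_lessThan lessThan_atLeast0)
    also have "(\<Sum>k\<in>{1..<K}. ?H k) \<le> (\<Sum>k\<in>{1..<K}. ?B * (1 / sqrt (real k) ^ 3 + 1 / real N ^ 2))"
    proof (intro sum_mono)
      fix k assume k: "k \<in> {1..<K}"
      have "?H k \<le> ?B * (1 / sqrt (real k) ^ 5 + 1 / real N ^ d)"
        using k assms by (intro abs_fourier_mean_le_gaussian_plus_equilibrium) auto
      also have "\<dots> \<le> ?B * (1 / sqrt (real k) ^ 3 + 1 / real N ^ 2)"
        using k by (intro mult_left_mono add_mono N2 divide_left_mono power_increasing) auto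
      finally show "?H k \<le> ?B * (1 / sqrt (real k) ^ 3 + 1 / real N ^ 2)" .
    qed
    also have "\<dots> = ?B * ((\<Sum>k\<in>{1..<K}. 1 / sqrt (real k) ^ 3) + real (K - 1) / real N ^ 2)"
      by (simp add: sum_distrib_left[symmetric] sum.distrib)
    also have "\<dots> \<le> ?B * (4 + 1)"
    proof (intro mult_left_mono add_mono)
      show "(\<Sum>k\<in>{1..<K}. 1 / sqrt (real k) ^ 3) \<le> 4" using sum_inverse_sqrt_cube_le[of 1 K] by simp
      have "real (K - 1) \<le> real N ^ 2" by (simp add: K_def flip: of_nat_power)
      then show "real (K - 1) / real N ^ 2 \<le> 1" using assms by (simp add: divide_le_eq)
    qed simp
    finally show ?thesis using H0 by simp
  qed
  also have "real d * real K / 2 * ?H K \<le> real d * real K / 2 * (?B / real K)"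
  proof (intro mult_left_mono)
    have "?H K \<le> ?B * (1 / real N ^ d)" using abs_fourier_mean_le_equilibrium[of d N K] assms by (simp add: K_def)
    also have "\<dots> \<le> ?B * (1 / real N ^ 2)" using N2 by (intro mult_left_mono) auto
    finally show "?H K \<le> ?B / real K" by (simp add: K_def)
  qed simp
  also have "\<dots> = real d / 2 * ?B" using assms by (simp add: K_def)
  finally have "(\<Sum>\<xi>\<in>?T. 1 / (1 - ?\<phi> \<xi>)) / real N ^ d \<le> 1 + ?B * 5 + real d / 2 * ?B" by simp
  also have "\<dots> \<le> green_bound d" by (simp add: green_bound_def algebra_simps)
  finally show ?thesis .
qed

lemma sum_power_dist_le:
  fixes x :: real
  assumes "\<bar>x\<bar> \<le> 1" "x < 1" "s < M"
  shows "(\<Sum>t<M. x ^ (max s t - min s t)) \<le> 4 / (1 - x)"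
proof -
  have geo: "(\<Sum>j<n. x ^ j) \<le> 2 / (1 - x)" for n
  proof -
    have "\<bar>x ^ n\<bar> \<le> 1" using assms by (simp add: power_abs power_le_one)
    have "(\<Sum>j<n. x ^ j) = (x ^ n - 1) / (x - 1)" using assms by (intro geometric_sum) auto
    also have "\<dots> = (1 - x ^ n) / (1 - x)" by (metis minus_diff_eq minus_divide_divide)
    also have "\<dots> \<le> 2 / (1 - x)" using assms \<open>\<bar>x ^ n\<bar> \<le> 1\<close> by (intro divide_right_mono) auto
    finally show ?thesis .
  qed
  have "{..<M} = {..<Suc s} \<union> {Suc s..<M}" using assms by auto
  then have "(\<Sum>t<M. x ^ (max s t - min s t))
      = (\<Sum>t<Suc s. x ^ (max s t - min s t)) + (\<Sum>t\<in>{Suc s..<M}. x ^ (max s t - min s t))"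
    by (simp only: sum.union_disjoint[OF finite_lessThan finite_atLeastLessThan] ivl_disj_int)
  also have "(\<Sum>t<Suc s. x ^ (max s t - min s t)) = (\<Sum>t<Suc s. x ^ (Suc s - Suc t))"
    by (intro sum.cong) (auto simp: max_def min_def)
  also have "\<dots> = (\<Sum>j<Suc s. x ^ j)" by (rule sum.nat_diff_reindex)
  also have "(\<Sum>t\<in>{Suc s..<M}. x ^ (max s t - min s t)) = (\<Sum>j\<in>{1..<M - s}. x ^ j)"
    by (rule sum.reindex_bij_witness[of _ "\<lambda>j. j + s" "\<lambda>t. t - s"]) (auto simp: max_def min_def)
  also have "\<dots> = (\<Sum>j<M - s. x ^ j) - 1"
    using assms by (simp add: lessThan_atLeast0 sum.atLeast_Suc_lessThan)
  finally have eq: "(\<Sum>t<M. x ^ (max s t - min s t)) = (\<Sum>j<Suc s. x ^ j) + ((\<Sum>j<M - s. x ^ j) - 1)" .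
  have "4 / (1 - x) = 2 / (1 - x) + 2 / (1 - x)" by simp
  then show ?thesis using eq geo[of "Suc s"] geo[of "M - s"] by linarith
qed

text \<open>
  In the Fourier expansion the zero frequency gives the term \<open>M^2 / N^d\<close> that independent uniform positions would produce,
  and the other frequencies sum to the Green function.
\<close>

lemma sum_return_prob_le:
  assumes "d \<ge> 5" "N > 0"
  shows "(\<Sum>s<M. \<Sum>t<M. walk_kernel d N (max s t - min s t) (\<lambda>_. 0))
    \<le> real M ^ 2 / real N ^ d + 4 * real M * green_bound d"
proof -
  let ?\<phi> = "char_fun d N" and ?o = "torus_origin d"
  have d: "d > 0" using assms by simp
  have "(\<Sum>s<M. \<Sum>t<M. walk_kernel d N (max s t - min s t) (\<lambda>_. 0))
    = (\<Sum>s<M. \<Sum>t<M. (\<Sum>\<xi>\<in>torus d N. ?\<phi> \<xi> ^ (max s t - min s t)) / real N ^ d)"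
    unfolding walk_kernel_fourier[OF d assms(2)] by simp
  also have "\<dots> = (\<Sum>\<xi>\<in>torus d N. \<Sum>s<M. \<Sum>t<M. ?\<phi> \<xi> ^ (max s t - min s t)) / real N ^ d"
    unfolding sum_divide_distrib[symmetric]
    by (simp only: sum.swap[of _ "torus d N"])
  also have "(\<Sum>\<xi>\<in>torus d N. \<Sum>s<M. \<Sum>t<M. ?\<phi> \<xi> ^ (max s t - min s t))
    = (\<Sum>s<M. \<Sum>t<M. ?\<phi> ?o ^ (max s t - min s t)) + (\<Sum>\<xi>\<in>torus d N - {?o}. \<Sum>s<M. \<Sum>t<M. ?\<phi> \<xi> ^ (max s t - min s t))"
    by (rule sum.remove[OF finite_torus torus_origin_in[OF assms(2)]])
  also have "(\<Sum>s<M. \<Sum>t<M. ?\<phi> ?o ^ (max s t - min s t)) = real M ^ 2"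
    by (simp add: char_fun_origin[OF d] power2_eq_square)
  also have "(\<Sum>\<xi>\<in>torus d N - {?o}. \<Sum>s<M. \<Sum>t<M. ?\<phi> \<xi> ^ (max s t - min s t))
    \<le> (\<Sum>\<xi>\<in>torus d N - {?o}. \<Sum>s<M. 4 / (1 - ?\<phi> \<xi>))"
  proof (intro sum_mono sum_power_dist_le abs_char_fun_le_1)
    fix \<xi> assume "\<xi> \<in> torus d N - {?o}"
    from char_fun_gap[OF d assms(2) this] show "?\<phi> \<xi> < 1"
      using assms by (smt (verit) d divide_pos_pos mult_pos_pos of_nat_0_less_iff zero_less_power)
  qed auto
  also have "\<dots> = 4 * real M * (\<Sum>\<xi>\<in>torus d N - {?o}. 1 / (1 - ?\<phi> \<xi>))"
    by (simp add: sum_distrib_left mult_ac)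
  finally have "(\<Sum>s<M. \<Sum>t<M. walk_kernel d N (max s t - min s t) (\<lambda>_. 0))
     \<le> (real M ^ 2 + 4 * real M * (\<Sum>\<xi>\<in>torus d N - {?o}. 1 / (1 - ?\<phi> \<xi>))) / real N ^ d"
    by (simp add: divide_right_mono)
  also have "\<dots> = real M ^ 2 / real N ^ d + 4 * real M * ((\<Sum>\<xi>\<in>torus d N - {?o}. 1 / (1 - ?\<phi> \<xi>)) / real N ^ d)"
    by (simp add: add_divide_distrib)
  also have "\<dots> \<le> real M ^ 2 / real N ^ d + 4 * real M * green_bound d"
    by (intro add_left_mono mult_left_mono spectral_green_le assms) auto
  finally show ?thesis .
qed

lemma finite_step_lists: "d > 0 \<Longrightarrow> finite (set_pmf (step_lists d n))"
  using finite_unit_steps[of d] unit_steps_nonempty[of d]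
  by (simp add: set_replicate_pmf lists_eq_set finite_lists_length_eq)

lemma prob_eq_expectation_of_bool:
  "measure_pmf.prob p {x. P x} = measure_pmf.expectation p (\<lambda>x. of_bool (P x))"
proof -
  have "(\<lambda>x. of_bool (P x)) = (indicator {x. P x} :: _ \<Rightarrow> real)" by (auto simp: fun_eq_iff indicator_def)
  then show ?thesis by simp
qed

lemma prob_list_walk_meet:
  assumes "s \<le> n" "t \<le> n"
  shows "measure_pmf.prob (step_lists d n) {xs. list_walk d N b xs s = list_walk d N b xs t}
    = walk_kernel d N (max s t - min s t) (\<lambda>_. 0)"
proof (cases "s \<le> t")
  case True
  then show ?thesis using prob_return[of s t n d N b] assms by (simp add: max_def min_def)
next
  case False
  have "{xs. list_walk d N b xs s = list_walk d N b xs t} = {xs. list_walk d N b xs t = list_walk d N b xs s}"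
    by auto
  then show ?thesis using prob_return[of t s n d N b] assms False by (simp add: max_def min_def)
qed

text \<open>
  Chebyshev's inequality for the number \<open>V e\<close> of visits to \<open>e\<close>. For each path the sum of \<open>V e\<close> over \<open>e\<close> is
  exactly \<open>M\<close>, and the sum of its squares counts the pairs of times at which the path is in the same place.
\<close>

lemma mean_prob_not_hit_le:
  assumes "d \<ge> 5" "N > 0" "M > 0"
  shows "(\<Sum>e\<in>torus d N. measure_pmf.prob (step_lists d M) {xs. \<forall>t<M. list_walk d N b xs t \<noteq> e}) / real N ^ d
    \<le> 4 * green_bound d * real N ^ d / real M"
proof -
  let ?p = "step_lists d M" and ?X = "list_walk d N b" and ?T = "torus d N"
  let ?E = "measure_pmf.expectation ?p"
  define \<mu> where "\<mu> = real M / real N ^ d"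
  have int: "integrable ?p f" for f :: "(nat \<Rightarrow> int) list \<Rightarrow> real"
    using assms by (intro integrable_measure_pmf_finite finite_step_lists) auto
  have \<mu>: "\<mu> > 0" using assms by (simp add: \<mu>_def)
  define V where "V xs e = (\<Sum>t<M. of_bool (?X xs t = e) :: real)" for xs e
  have point: "\<mu>^2 * (\<Sum>e\<in>?T. of_bool (\<forall>t<M. ?X xs t \<noteq> e)) \<le> (\<Sum>s<M. \<Sum>t<M. of_bool (?X xs s = ?X xs t)) - real M ^ 2 / real N ^ d" for xs
  proof -
    have "\<mu>^2 * (\<Sum>e\<in>?T. of_bool (\<forall>t<M. ?X xs t \<noteq> e)) \<le> (\<Sum>e\<in>?T. (V xs e - \<mu>)^2)"
      unfolding sum_distrib_left
    proof (intro sum_mono)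
      fix e
      have "V xs e = 0" if "\<forall>t<M. ?X xs t \<noteq> e" using that by (simp add: V_def)
      then show "\<mu>^2 * of_bool (\<forall>t<M. ?X xs t \<noteq> e) \<le> (V xs e - \<mu>)^2" by auto
    qed
    also have "\<dots> = (\<Sum>e\<in>?T. (V xs e)^2) - 2 * \<mu> * (\<Sum>e\<in>?T. V xs e) + \<mu>^2 * real N ^ d"
      by (simp add: power2_diff sum.distrib sum_subtractf sum_distrib_left card_torus mult_ac)
    also have "(\<Sum>e\<in>?T. V xs e) = real M"
      unfolding V_def using list_walk_in_torus[OF assms(2), of d b xs]
      by (subst sum.swap) (simp add: of_bool_def sum.delta' finite_torus)
    also have "(\<Sum>e\<in>?T. (V xs e)^2) = (\<Sum>s<M. \<Sum>t<M. \<Sum>e\<in>?T. of_bool (?X xs s = e) * of_bool (?X xs t = e))"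
      unfolding V_def power2_eq_square sum_product by (simp only: sum.swap[of _ "{..<M}" ?T])
    also have "\<dots> = (\<Sum>s<M. \<Sum>t<M. of_bool (?X xs s = ?X xs t))"
    proof (intro sum.cong refl)
      fix s t
      have "(\<Sum>e\<in>?T. of_bool (?X xs s = e) * of_bool (?X xs t = e)) = (\<Sum>e\<in>?T. if ?X xs s = e then of_bool (?X xs t = ?X xs s) else 0 :: real)"
        by (intro sum.cong) auto
      then show "(\<Sum>e\<in>?T. of_bool (?X xs s = e) * of_bool (?X xs t = e)) = (of_bool (?X xs s = ?X xs t) :: real)"
        using list_walk_in_torus[OF assms(2), of d b xs s] by (simp add: finite_torus eq_commute)
    qed
    finally show ?thesis using assms by (simp add: \<mu>_def power2_eq_square field_simps)
  qed
  have "\<mu>^2 * (\<Sum>e\<in>?T. measure_pmf.prob ?p {xs. \<forall>t<M. ?X xs t \<noteq> e})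
    = ?E (\<lambda>xs. \<mu>^2 * (\<Sum>e\<in>?T. of_bool (\<forall>t<M. ?X xs t \<noteq> e)))"
    unfolding prob_eq_expectation_of_bool by (simp add: int Bochner_Integration.integral_sum)
  also have "\<dots> \<le> ?E (\<lambda>xs. (\<Sum>s<M. \<Sum>t<M. of_bool (?X xs s = ?X xs t)) - real M ^ 2 / real N ^ d)"
    by (intro integral_mono int point)
  also have "\<dots> = (\<Sum>s<M. \<Sum>t<M. measure_pmf.prob ?p {xs. ?X xs s = ?X xs t}) - real M ^ 2 / real N ^ d"
    unfolding prob_eq_expectation_of_bool
    by (simp add: int Bochner_Integration.integral_sum del: sum_of_bool_eq)
  also have "\<dots> = (\<Sum>s<M. \<Sum>t<M. walk_kernel d N (max s t - min s t) (\<lambda>_. 0)) - real M ^ 2 / real N ^ d"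
    by (simp add: prob_list_walk_meet)
  also have "\<dots> \<le> 4 * real M * green_bound d" using sum_return_prob_le[OF assms(1,2), of M] by simp
  finally have "(\<Sum>e\<in>?T. measure_pmf.prob ?p {xs. \<forall>t<M. ?X xs t \<noteq> e}) \<le> 4 * real M * green_bound d / \<mu>^2"
    using \<mu> by (simp add: field_simps)
  then have "(\<Sum>e\<in>?T. measure_pmf.prob ?p {xs. \<forall>t<M. ?X xs t \<noteq> e}) / real N ^ d \<le> 4 * real M * green_bound d / \<mu>^2 / real N ^ d"
    by (rule divide_right_mono) simp
  also have "\<dots> = 4 * green_bound d * real N ^ d / real M"
    using assms by (simp add: \<mu>_def power2_eq_square field_simps)
  finally show ?thesis .
qed

section \<open>Few cut windows are unlikely\<close>

text \<open>
  A given difference \<open>j\<close> arises from at most \<open>j\<close> pairs, because \<open>x\<close> and \<open>x + j\<close> lie on different sides of the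
  window.
\<close>

lemma sum_difference_le:
  fixes g :: "nat \<Rightarrow> real"
  assumes "\<alpha> < \<beta>" and g: "\<And>j. 0 \<le> g j"
  shows "(\<Sum>x\<in>{u..\<alpha>}. \<Sum>y\<in>{\<beta>..t}. g (y - x)) \<le> (\<Sum>j\<in>{\<beta> - \<alpha>..<Suc (t - u)}. real j * g j)"
proof -
  let ?P = "{u..\<alpha>} \<times> {\<beta>..t}" and ?J = "{\<beta> - \<alpha>..<Suc (t - u)}"
  have "(\<Sum>x\<in>{u..\<alpha>}. \<Sum>y\<in>{\<beta>..t}. g (y - x)) = (\<Sum>z\<in>?P. g (snd z - fst z))"
    by (simp add: sum.cartesian_product split_def)
  also have "\<dots> = (\<Sum>j\<in>?J. \<Sum>z\<in>{z \<in> ?P. snd z - fst z = j}. g (snd z - fst z))"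
    by (rule sum.group[symmetric]) (auto intro!: diff_le_mono2 diff_le_mono le_imp_less_Suc)
  also have "\<dots> = (\<Sum>j\<in>?J. real (card {z \<in> ?P. snd z - fst z = j}) * g j)"
    by (intro sum.cong refl) simp
  also have "\<dots> \<le> (\<Sum>j\<in>?J. real j * g j)"
  proof (intro sum_mono mult_right_mono g of_nat_mono)
    fix j assume j: "j \<in> ?J"
    let ?A = "{z \<in> ?P. snd z - fst z = j}"
    have "inj_on fst ?A" using assms(1) by (auto simp: inj_on_def)
    moreover have "fst ` ?A \<subseteq> {\<beta> - j..\<alpha>}" by auto
    ultimately have "card ?A \<le> card {\<beta> - j..\<alpha>}" by (intro card_inj_on_le) auto
    also have "\<dots> \<le> j" using assms(1) by simp
    finally show "card ?A \<le> j" .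
  qed
  finally show ?thesis .
qed

text \<open>
  Union bound over all loops that cross the window. The number of loops of length \<open>j\<close> is at most \<open>j\<close>, and each closes
  with probability \<open>O(j^(-5/2) + N^(-d))\<close>; the resulting series \<open>j^(-3/2)\<close> converges.
\<close>

lemma prob_not_cut_window_le:
  assumes "d \<ge> 5" "N > 0" "\<alpha> < \<beta>" "\<beta> \<le> t" "t \<le> n" "u \<le> \<alpha>"
  shows "measure_pmf.prob (step_lists d n) {xs. \<not> cut_window (list_walk d N b xs) u \<alpha> \<beta> t}
    \<le> (24 * real d) ^ d * (4 / sqrt (real (\<beta> - \<alpha>)) + real (t - u) ^ 2 / real N ^ d)"
proof -
  let ?p = "step_lists d n" and ?X = "list_walk d N b" and ?B = "(24 * real d) ^ d"
  define g where "g j = ?B * (1 / sqrt (real j) ^ 5 + 1 / real N ^ d)" for j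
  have g0: "0 \<le> g j" for j by (simp add: g_def)
  have "{xs. \<not> cut_window (?X xs) u \<alpha> \<beta> t} = (\<Union>x\<in>{u..\<alpha>}. \<Union>y\<in>{\<beta>..t}. {xs. ?X xs x = ?X xs y})"
    by (auto simp: cut_window_def)
  then have "measure_pmf.prob ?p {xs. \<not> cut_window (?X xs) u \<alpha> \<beta> t}
    = measure_pmf.prob ?p (\<Union>x\<in>{u..\<alpha>}. \<Union>y\<in>{\<beta>..t}. {xs. ?X xs x = ?X xs y})" by (rule arg_cong)
  also have "\<dots> \<le> (\<Sum>x\<in>{u..\<alpha>}. measure_pmf.prob ?p (\<Union>y\<in>{\<beta>..t}. {xs. ?X xs x = ?X xs y}))"
    by (rule measure_pmf.finite_measure_subadditive_finite) auto
  also have "\<dots> \<le> (\<Sum>x\<in>{u..\<alpha>}. \<Sum>y\<in>{\<beta>..t}. measure_pmf.prob ?p {xs. ?X xs x = ?X xs y})"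
    by (rule sum_mono, rule measure_pmf.finite_measure_subadditive_finite) auto
  also have "\<dots> \<le> (\<Sum>x\<in>{u..\<alpha>}. \<Sum>y\<in>{\<beta>..t}. g (y - x))"
  proof (intro sum_mono)
    fix x y assume xy: "x \<in> {u..\<alpha>}" "y \<in> {\<beta>..t}"
    then have "measure_pmf.prob ?p {xs. ?X xs x = ?X xs y} = walk_kernel d N (y - x) (\<lambda>_. 0)"
      using assms by (intro prob_return) auto
    also have "\<dots> \<le> abs_fourier_mean d N (y - x)"
      using assms by (intro walk_kernel_le_abs_fourier_mean) auto
    also have "\<dots> \<le> g (y - x)"
      unfolding g_def using assms xy by (intro abs_fourier_mean_le_gaussian_plus_equilibrium) auto
    finally show "measure_pmf.prob ?p {xs. ?X xs x = ?X xs y} \<le> g (y - x)" .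
  qed
  also have "\<dots> \<le> (\<Sum>j\<in>{\<beta> - \<alpha>..<Suc (t - u)}. real j * g j)"
    by (rule sum_difference_le[OF assms(3) g0])
  also have "\<dots> \<le> (\<Sum>j\<in>{\<beta> - \<alpha>..<Suc (t - u)}. ?B * (1 / sqrt (real j) ^ 3 + real (t - u) / real N ^ d))"
  proof (intro sum_mono)
    fix j assume j: "j \<in> {\<beta> - \<alpha>..<Suc (t - u)}"
    then have "j > 0" using assms by auto
    define w where "w = sqrt (real j)"
    have w: "w > 0" "real j = w^2" using \<open>j > 0\<close> by (simp_all add: w_def)
    have "w^2 / w^5 = 1 / w^3" using w(1) by (simp add: field_simps eval_nat_numeral)
    then have eq: "real j / sqrt (real j) ^ 5 = 1 / sqrt (real j) ^ 3"
      using w by (simp add: w_def[symmetric])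
    have "real j * g j = ?B * (real j / sqrt (real j) ^ 5 + real j / real N ^ d)"
      by (simp add: g_def algebra_simps)
    also have "\<dots> \<le> ?B * (1 / sqrt (real j) ^ 3 + real (t - u) / real N ^ d)"
      unfolding eq using j by (intro mult_left_mono add_left_mono divide_right_mono) auto
    finally show "real j * g j \<le> ?B * (1 / sqrt (real j) ^ 3 + real (t - u) / real N ^ d)" .
  qed
  also have "\<dots> = ?B * ((\<Sum>j\<in>{\<beta> - \<alpha>..<Suc (t - u)}. 1 / sqrt (real j) ^ 3)
      + real (Suc (t - u) - (\<beta> - \<alpha>)) * (real (t - u) / real N ^ d))"
    by (simp add: sum_distrib_left[symmetric] sum.distrib)
  also have "\<dots> \<le> ?B * (4 / sqrt (real (\<beta> - \<alpha>)) + real (t - u) ^ 2 / real N ^ d)"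
  proof (intro mult_left_mono add_mono)
    show "(\<Sum>j\<in>{\<beta> - \<alpha>..<Suc (t - u)}. 1 / sqrt (real j) ^ 3) \<le> 4 / sqrt (real (\<beta> - \<alpha>))"
      using assms by (intro sum_inverse_sqrt_cube_le) auto
    have "real (Suc (t - u) - (\<beta> - \<alpha>)) * (real (t - u) / real N ^ d) \<le> real (t - u) * (real (t - u) / real N ^ d)"
      using assms by (intro mult_right_mono) auto
    then show "real (Suc (t - u) - (\<beta> - \<alpha>)) * (real (t - u) / real N ^ d) \<le> real (t - u) ^ 2 / real N ^ d"
      by (simp add: power2_eq_square)
  qed simp
  finally show ?thesis .
qed

text \<open>
  Chebyshev's inequality: the mean number of events that occur is at least \<open>Q / 2\<close>, so at most \<open>Q / 4\<close> of them occur
  only if the number deviates from its mean by at least \<open>Q / 4\<close>.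
\<close>

lemma prob_few_events_le:
  fixes p :: "'a pmf" and G :: "nat \<Rightarrow> 'a \<Rightarrow> bool" and \<delta> :: "nat \<Rightarrow> real"
  assumes fin: "finite (set_pmf p)" and "Q > 0" and r: "real r \<le> real Q / 4"
    and half: "\<And>q. q < Q \<Longrightarrow> 1/2 \<le> measure_pmf.prob p {x. G q x}"
    and cov: "\<And>q q'. q < q' \<Longrightarrow> q' < Q \<Longrightarrow> measure_pmf.prob p {x. G q x \<and> G q' x}
      \<le> measure_pmf.prob p {x. G q x} * measure_pmf.prob p {x. G q' x} + \<delta> (q' - q)"
    and \<delta>: "\<And>k. 0 \<le> \<delta> k"
  shows "measure_pmf.prob p {x. card {q. q < Q \<and> G q x} \<le> r} \<le> 16 * (1 + 2 * (\<Sum>k\<in>{1..Q}. \<delta> k)) / real Q"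
proof -
  let ?E = "measure_pmf.expectation p" and ?P = "\<lambda>q. measure_pmf.prob p {x. G q x}"
  let ?P2 = "\<lambda>q q'. measure_pmf.prob p {x. G q x \<and> G q' x}"
  have int: "integrable p f" for f :: "'a \<Rightarrow> real" by (rule integrable_measure_pmf_finite[OF fin])
  define Z where "Z x = (\<Sum>q<Q. of_bool (G q x) :: real)" for x
  define m where "m = (\<Sum>q<Q. ?P q)"
  have Z: "Z x = real (card {q. q < Q \<and> G q x})" for x
    by (simp add: Z_def Int_def conj_commute)
  have m: "real Q / 2 \<le> m"
  proof -
    have "(\<Sum>q<Q. 1/2) \<le> m" unfolding m_def by (intro sum_mono half) auto
    then show ?thesis by simp
  qed
  have EZ: "?E Z = m" unfolding Z_def m_def prob_eq_expectation_of_bool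
    by (simp add: int Bochner_Integration.integral_sum del: sum_of_bool_eq)
  have EZ2: "?E (\<lambda>x. Z x ^ 2) = (\<Sum>q<Q. \<Sum>q'<Q. ?P2 q q')"
  proof -
    have "Z x ^ 2 = (\<Sum>q<Q. \<Sum>q'<Q. of_bool (G q x \<and> G q' x))" for x
      unfolding Z_def power2_eq_square sum_product of_bool_conj ..
    then show ?thesis unfolding prob_eq_expectation_of_bool
      by (simp only: int Bochner_Integration.integral_sum)
  qed
  have pair: "?P2 q q' - ?P q * ?P q' \<le> (if q = q' then 1 else \<delta> (max q q' - min q q'))" if "q < Q" "q' < Q" for q q'
  proof -
    consider "q = q'" | "q < q'" | "q' < q" by linarith
    then show ?thesis
    proof cases
      case 1
      have "?P2 q q' - ?P q * ?P q' \<le> ?P2 q q'" by simp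
      also have "\<dots> \<le> 1" by simp
      finally show ?thesis using 1 by simp
    next
      case 2
      then show ?thesis using cov[of q q'] that by simp
    next
      case 3
      then show ?thesis using cov[of q' q] that by (simp add: conj_commute mult.commute)
    qed
  qed
  have row: "(\<Sum>q'<Q. if q = q' then 1 else \<delta> (max q q' - min q q')) \<le> 1 + 2 * (\<Sum>k\<in>{1..Q}. \<delta> k)" if "q < Q" for q
  proof -
    have "(\<Sum>q'<Q. if q = q' then 1 else \<delta> (max q q' - min q q'))
      = 1 + (\<Sum>q'\<in>{..<Q} - {q}. \<delta> (max q q' - min q q'))"
      using that by (subst sum.remove[of _ q]) (auto intro!: sum.cong)
    also have "{..<Q} - {q} = {..<q} \<union> {Suc q..<Q}" using that by auto
    also have "(\<Sum>q'\<in>{..<q} \<union> {Suc q..<Q}. \<delta> (max q q' - min q q'))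
      = (\<Sum>q'\<in>{..<q}. \<delta> (max q q' - min q q')) + (\<Sum>q'\<in>{Suc q..<Q}. \<delta> (max q q' - min q q'))"
      by (intro sum.union_disjoint) auto
    also have "(\<Sum>q'\<in>{..<q}. \<delta> (max q q' - min q q')) = (\<Sum>k\<in>{1..q}. \<delta> k)"
      by (rule sum.reindex_bij_witness[of _ "\<lambda>k. q - k" "\<lambda>q'. q - q'"]) auto
    also have "(\<Sum>q'\<in>{Suc q..<Q}. \<delta> (max q q' - min q q')) = (\<Sum>k\<in>{1..<Q - q}. \<delta> k)"
      by (rule sum.reindex_bij_witness[of _ "\<lambda>k. k + q" "\<lambda>q'. q' - q"]) auto
    also have "(\<Sum>k\<in>{1..q}. \<delta> k) \<le> (\<Sum>k\<in>{1..Q}. \<delta> k)" using that \<delta> by (intro sum_mono2) auto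
    also have "(\<Sum>k\<in>{1..<Q - q}. \<delta> k) \<le> (\<Sum>k\<in>{1..Q}. \<delta> k)" using that \<delta> by (intro sum_mono2) auto
    finally show ?thesis by simp
  qed
  have "(real Q / 4)^2 * measure_pmf.prob p {x. card {q. q < Q \<and> G q x} \<le> r}
    = ?E (\<lambda>x. (real Q / 4)^2 * of_bool (card {q. q < Q \<and> G q x} \<le> r))"
    unfolding prob_eq_expectation_of_bool by (simp add: int)
  also have "\<dots> \<le> ?E (\<lambda>x. (Z x - m)^2)"
  proof (intro integral_mono int)
    fix x
    show "(real Q / 4)^2 * of_bool (card {q. q < Q \<and> G q x} \<le> r) \<le> (Z x - m)^2"
    proof (cases "card {q. q < Q \<and> G q x} \<le> r")
      case True
      then have "Z x \<le> real Q / 4" unfolding Z using r by linarith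
      then have "real Q / 4 \<le> \<bar>Z x - m\<bar>" using m by linarith
      then have "(real Q / 4)^2 \<le> \<bar>Z x - m\<bar>^2" by (intro power_mono) auto
      then show ?thesis using True by simp
    qed simp
  qed
  also have "\<dots> = ?E (\<lambda>x. Z x ^ 2) - m^2"
    by (simp add: power2_diff int EZ measure_pmf.prob_space) (simp add: power2_eq_square)
  also have "\<dots> = (\<Sum>q<Q. \<Sum>q'<Q. ?P2 q q' - ?P q * ?P q')"
    unfolding EZ2 unfolding m_def power2_eq_square sum_product by (simp add: sum_subtractf)
  also have "\<dots> \<le> (\<Sum>q<Q. \<Sum>q'<Q. if q = q' then 1 else \<delta> (max q q' - min q q'))"
    by (intro sum_mono pair) auto
  also have "\<dots> \<le> (\<Sum>q<Q. 1 + 2 * (\<Sum>k\<in>{1..Q}. \<delta> k))"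
    by (intro sum_mono row) auto
  also have "\<dots> = real Q * (1 + 2 * (\<Sum>k\<in>{1..Q}. \<delta> k))" by simp
  finally have "(real Q / 4)^2 * measure_pmf.prob p {x. card {q. q < Q \<and> G q x} \<le> r}
    \<le> real Q * (1 + 2 * (\<Sum>k\<in>{1..Q}. \<delta> k))" .
  then have "real Q * (real Q * measure_pmf.prob p {x. card {q. q < Q \<and> G q x} \<le> r})
    \<le> real Q * (16 * (1 + 2 * (\<Sum>k\<in>{1..Q}. \<delta> k)))"
    by (simp add: power2_eq_square field_simps)
  then have "real Q * measure_pmf.prob p {x. card {q. q < Q \<and> G q x} \<le> r} \<le> 16 * (1 + 2 * (\<Sum>k\<in>{1..Q}. \<delta> k))"
    using \<open>Q > 0\<close> by (simp only: mult_le_cancel_left_pos of_nat_0_less_iff)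
  then show ?thesis using \<open>Q > 0\<close> by (simp add: pos_le_divide_eq mult.commute)
qed

lemma list_walk_take: "x \<le> h \<Longrightarrow> list_walk d N b (take h xs) x = list_walk d N b xs x"
  by (simp add: list_walk_def min_def)

lemma cut_window_take:
  assumes "\<alpha> \<le> h" "t \<le> h"
  shows "cut_window (list_walk d N b (take h xs)) u \<alpha> \<beta> t \<longleftrightarrow> cut_window (list_walk d N b xs) u \<alpha> \<beta> t"
  using assms unfolding cut_window_def by (auto simp: list_walk_take)

lemma list_walk_drop_eq_iff:
  assumes "h \<le> x" "x \<le> y"
  shows "list_walk d N c (drop h xs) (x - h) = list_walk d N c (drop h xs) (y - h)
    \<longleftrightarrow> list_walk d N b xs x = list_walk d N b xs y"
  using assms by (simp add: list_walk_eq_iff)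

text \<open>
  The cut window expressed through the steps after time \<open>h\<close> alone, for a window in that part of the path.
\<close>

definition shifted_cut_window :: "nat \<Rightarrow> nat \<Rightarrow> nat \<Rightarrow> nat \<Rightarrow> nat \<Rightarrow> nat \<Rightarrow> (nat \<Rightarrow> int) list \<Rightarrow> bool" where
  "shifted_cut_window d N h \<alpha> \<beta> t ys \<longleftrightarrow>
    (\<forall>x\<in>{h..\<alpha>}. \<forall>y\<in>{\<beta>..t}. list_walk d N (\<lambda>_. 0) ys (x - h) \<noteq> list_walk d N (\<lambda>_. 0) ys (y - h))"

lemma shifted_cut_window_drop:
  assumes "\<alpha> \<le> \<beta>"
  shows "shifted_cut_window d N h \<alpha> \<beta> t (drop h xs) \<longleftrightarrow> cut_window (list_walk d N b xs) h \<alpha> \<beta> t"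
  unfolding shifted_cut_window_def cut_window_def
  using assms by (intro ball_cong refl) (simp add: list_walk_drop_eq_iff[where b = b])

lemma prob_cut_windows_indep:
  assumes "h \<le> n" "\<alpha> \<le> h" "\<alpha>' \<le> \<beta>'"
  shows "measure_pmf.prob (step_lists d n)
      {xs. cut_window (list_walk d N b xs) u \<alpha> \<beta> h \<and> cut_window (list_walk d N b xs) h \<alpha>' \<beta>' t}
    = measure_pmf.prob (step_lists d n) {xs. cut_window (list_walk d N b xs) u \<alpha> \<beta> h}
      * measure_pmf.prob (step_lists d n) {xs. cut_window (list_walk d N b xs) h \<alpha>' \<beta>' t}"
proof -
  let ?L = "\<lambda>xs. cut_window (list_walk d N b xs) u \<alpha> \<beta> h" and ?R = "shifted_cut_window d N h \<alpha>' \<beta>' t"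
  let ?q = "step_lists d h" and ?q' = "step_lists d (n - h)"
  have L: "cut_window (list_walk d N b xs) u \<alpha> \<beta> h \<longleftrightarrow> ?L (take h xs)" for xs
    using assms by (simp add: cut_window_take)
  have R: "cut_window (list_walk d N b xs) h \<alpha>' \<beta>' t \<longleftrightarrow> ?R (drop h xs)" for xs
    by (rule shifted_cut_window_drop[OF assms(3), symmetric])
  have 1: "measure_pmf.prob (step_lists d n) {xs. ?L (take h xs) \<and> ?R (drop h xs)}
    = measure_pmf.prob ?q {x. ?L x} * measure_pmf.prob ?q' {y. ?R y}"
    unfolding prob_split_replicate_pmf[OF assms(1), of _ "\<lambda>x y. ?L x \<and> ?R y"] by (rule prob_pair_pmf_indep)
  have 2: "measure_pmf.prob (step_lists d n) {xs. ?L (take h xs)} = measure_pmf.prob ?q {x. ?L x}"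
    using prob_slice_replicate_pmf[of 0 h n _ ?L] assms by simp
  have 3: "measure_pmf.prob (step_lists d n) {xs. ?R (drop h xs)} = measure_pmf.prob ?q' {y. ?R y}"
    unfolding prob_split_replicate_pmf[OF assms(1), of _ "\<lambda>x y. ?R y"]
    using prob_pair_pmf_indep[of ?q ?q' "\<lambda>x. True" ?R] by simp
  show ?thesis unfolding R using 1 2 3 L by simp
qed

lemma cut_window_mono:
  "cut_window \<gamma> u \<alpha> \<beta> t \<Longrightarrow> u \<le> u' \<Longrightarrow> t' \<le> t \<Longrightarrow> cut_window \<gamma> u' \<alpha> \<beta> t'"
  by (auto simp: cut_window_def)

lemma cut_window_join:
  "cut_window \<gamma> u \<alpha> \<beta> h \<Longrightarrow> cut_window \<gamma> u \<alpha> h t \<Longrightarrow> cut_window \<gamma> u \<alpha> \<beta> t"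
  "cut_window \<gamma> h \<alpha> \<beta> t \<Longrightarrow> cut_window \<gamma> u h \<beta> t \<Longrightarrow> cut_window \<gamma> u \<alpha> \<beta> t"
  unfolding cut_window_def by (meson atLeastAtMost_iff nle_le)+

text \<open>
  Cutting the path at a time \<open>h\<close> halfway between the windows replaces the two events by independent ones. They differ
  from the original events only if a loop crosses both one of the windows and \<open>h\<close>, and such a loop is at least half as
  long as the distance of the windows.
\<close>

lemma prob_cut_window_pair_le:
  fixes b :: "nat \<Rightarrow> int"
  assumes d: "d \<ge> 5" and N: "N > 0" and a: "a > 0" and q: "q < q'" "q' < Q" and v: "u \<le> v" "v + Q * a \<le> t" "t \<le> n"
  defines "G \<equiv> \<lambda>q xs. cut_window (list_walk d N b xs) u (v + q * a) (v + Suc q * a) t"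
  shows "measure_pmf.prob (step_lists d n) {xs. G q xs \<and> G q' xs}
    \<le> measure_pmf.prob (step_lists d n) {xs. G q xs} * measure_pmf.prob (step_lists d n) {xs. G q' xs}
      + 3 * ((24 * real d) ^ d * (6 / sqrt (real (q' - q)) + real (t - u) ^ 2 / real N ^ d))"
proof -
  let ?P = "\<lambda>F. measure_pmf.prob (step_lists d n) {xs. F xs}" and ?B = "(24 * real d) ^ d"
  let ?X = "list_walk d N b"
  define \<epsilon> where "\<epsilon> = ?B * (6 / sqrt (real (q' - q)) + real (t - u) ^ 2 / real N ^ d)"
  define j where "j = (q + 1 + q') div 2"
  \<comment> \<open>an endpoint of a window, so that neither of the two windows contains it in its interior\<close>
  define h where "h = v + j * a"
  have j: "q < j" "j \<le> q'" "q' - q \<le> 2 * (j - q)" "q' - q \<le> 2 * (Suc q' - j)"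
    using q by (auto simp: j_def)
  have Qa: "Suc q' * a \<le> Q * a" using q by (intro mult_le_mono1) auto
  have ord: "Suc q * a \<le> j * a" "j * a \<le> q' * a" by (rule mult_le_mono1, use j in simp)+
  have "j * a \<le> Q * a" by (rule mult_le_mono1) (use j q in simp)
  then have ht: "h \<le> t" unfolding h_def using v by linarith
  have "j * a < Suc q' * a" by (rule mult_less_mono1) (use j a in simp_all)
  then have hlt: "h < v + Suc q' * a" unfolding h_def by linarith
  have far: "?P (\<lambda>xs. \<not> cut_window (?X xs) u \<alpha> \<beta> t) \<le> \<epsilon>"
    if "\<alpha> < \<beta>" "u \<le> \<alpha>" "\<beta> \<le> t" "q' - q \<le> 2 * (\<beta> - \<alpha>)" for \<alpha> \<beta>
  proof -
    have "4 / sqrt (real (\<beta> - \<alpha>)) \<le> 6 / sqrt (real (q' - q))"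
    proof -
      have "real (q' - q) \<le> 2 * real (\<beta> - \<alpha>)" using that(4) by (metis of_nat_le_iff of_nat_mult of_nat_numeral)
      then have "sqrt (real (q' - q)) \<le> sqrt (9 / 4 * real (\<beta> - \<alpha>))" by (intro real_sqrt_le_mono) linarith
      also have "\<dots> = 3 / 2 * sqrt (real (\<beta> - \<alpha>))" by (simp add: real_sqrt_mult real_sqrt_divide)
      finally show ?thesis using that(1) q(1) by (simp add: field_simps)
    qed
    then have "?B * (4 / sqrt (real (\<beta> - \<alpha>)) + real (t - u) ^ 2 / real N ^ d) \<le> \<epsilon>"
      unfolding \<epsilon>_def by (intro mult_left_mono add_right_mono) auto
    moreover have "?P (\<lambda>xs. \<not> cut_window (?X xs) u \<alpha> \<beta> t)
      \<le> ?B * (4 / sqrt (real (\<beta> - \<alpha>)) + real (t - u) ^ 2 / real N ^ d)"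
      using that d N v by (intro prob_not_cut_window_le) auto
    ultimately show ?thesis by linarith
  qed
  have \<epsilon>0: "0 \<le> \<epsilon>" by (simp add: \<epsilon>_def)
  have scale: "x \<le> x * a" for x :: nat using a by simp
  define L where "L xs = cut_window (?X xs) u (v + q * a) (v + Suc q * a) h" for xs
  define R where "R xs = cut_window (?X xs) h (v + q' * a) (v + Suc q' * a) t" for xs
  have "?P L \<le> ?P (\<lambda>xs. G q xs \<or> \<not> cut_window (?X xs) u (v + q * a) h t)"
    by (intro measure_pmf.finite_measure_mono) (auto simp: L_def G_def intro: cut_window_join(1))
  also have "\<dots> \<le> ?P (G q) + ?P (\<lambda>xs. \<not> cut_window (?X xs) u (v + q * a) h t)"
    unfolding Collect_disj_eq by (intro measure_Un_le) auto
  also have "?P (\<lambda>xs. \<not> cut_window (?X xs) u (v + q * a) h t) \<le> \<epsilon>"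
  proof (rule far)
    have "h - (v + q * a) = (j - q) * a" by (simp add: h_def diff_mult_distrib)
    then show "q' - q \<le> 2 * (h - (v + q * a))" using j(3) scale[of "j - q"] by linarith
  qed (use a v ord Qa j ht in \<open>auto simp: h_def\<close>)
  finally have PL: "?P L \<le> ?P (G q) + \<epsilon>" by simp
  have "?P R \<le> ?P (\<lambda>xs. G q' xs \<or> \<not> cut_window (?X xs) u h (v + Suc q' * a) t)"
    by (intro measure_pmf.finite_measure_mono) (auto simp: R_def G_def intro: cut_window_join(2))
  also have "\<dots> \<le> ?P (G q') + ?P (\<lambda>xs. \<not> cut_window (?X xs) u h (v + Suc q' * a) t)"
    unfolding Collect_disj_eq by (intro measure_Un_le) auto
  also have "?P (\<lambda>xs. \<not> cut_window (?X xs) u h (v + Suc q' * a) t) \<le> \<epsilon>"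
  proof (rule far)
    have "v + Suc q' * a - h = (Suc q' - j) * a" by (simp add: h_def diff_mult_distrib)
    then show "q' - q \<le> 2 * (v + Suc q' * a - h)" using j(4) scale[of "Suc q' - j"] by linarith
  qed (use hlt in simp, (use v Qa in \<open>simp_all add: h_def\<close>))
  finally have PR: "?P R \<le> ?P (G q') + \<epsilon>" by simp
  have uh: "u \<le> h" using v by (simp add: h_def)
  have "L xs \<and> R xs" if "G q xs \<and> G q' xs" for xs
    using that cut_window_mono[OF _ order_refl ht] cut_window_mono[OF _ uh order_refl]
    unfolding L_def R_def G_def by blast
  then have "?P (\<lambda>xs. G q xs \<and> G q' xs) \<le> ?P (\<lambda>xs. L xs \<and> R xs)"
    by (intro measure_pmf.finite_measure_mono) auto
  also have "\<dots> = ?P L * ?P R"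
    unfolding L_def R_def using ord v ht j by (intro prob_cut_windows_indep) (auto simp: h_def)
  finally have PLR: "?P (\<lambda>xs. G q xs \<and> G q' xs) \<le> ?P L * ?P R" .
  show ?thesis unfolding \<epsilon>_def[symmetric]
  \<comment> \<open>for \<open>\<epsilon> > 1\<close> the bound is trivial; otherwise \<open>\<epsilon>^2 \<le> \<epsilon>\<close>\<close>
  proof (cases "\<epsilon> \<le> 1")
    case True
    have "?P L * ?P R \<le> (?P (G q) + \<epsilon>) * (?P (G q') + \<epsilon>)"
      using PL PR \<epsilon>0 by (intro mult_mono) auto
    also have "\<dots> = ?P (G q) * ?P (G q') + (?P (G q) * \<epsilon> + ?P (G q') * \<epsilon> + \<epsilon> * \<epsilon>)" by (simp add: algebra_simps)
    also have "?P (G q) * \<epsilon> + ?P (G q') * \<epsilon> + \<epsilon> * \<epsilon> \<le> 1 * \<epsilon> + 1 * \<epsilon> + 1 * \<epsilon>"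
      using \<epsilon>0 True by (intro add_mono mult_right_mono) auto
    finally show "?P (\<lambda>xs. G q xs \<and> G q' xs) \<le> ?P (G q) * ?P (G q') + 3 * \<epsilon>" using PLR by simp
  next
    case False
    have "?P (\<lambda>xs. G q xs \<and> G q' xs) \<le> 1" by simp
    moreover have "0 \<le> ?P (G q) * ?P (G q')" by simp
    ultimately show "?P (\<lambda>xs. G q xs \<and> G q' xs) \<le> ?P (G q) * ?P (G q') + 3 * \<epsilon>" using False by linarith
  qed
qed

lemma prob_few_cut_windows_le:
  assumes d: "d \<ge> 5" and N: "N > 0" and a: "(16 * (24 * real d) ^ d)^2 \<le> real a"
    and Q: "Q > 0" "real r \<le> real Q / 4" and t: "u \<le> v" "v + Q * a \<le> t" "t \<le> n"
  shows "measure_pmf.prob (step_lists d n)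
      {xs. card {q. q < Q \<and> cut_window (list_walk d N b xs) u (v + q * a) (v + Suc q * a) t} \<le> r}
    \<le> 1200 * (24 * real d) ^ d * (1 / sqrt (real Q) + real (t - u) ^ 2 / real N ^ d)"
proof (cases "(24 * real d) ^ d * (real (t - u) ^ 2 / real N ^ d) \<le> 1/4")
  case False
  let ?B = "(24 * real d) ^ d"
  have "measure_pmf.prob (step_lists d n)
      {xs. card {q. q < Q \<and> cut_window (list_walk d N b xs) u (v + q * a) (v + Suc q * a) t} \<le> r} \<le> 1" by simp
  also have "1 \<le> 1200 * (?B * (real (t - u) ^ 2 / real N ^ d))" using False by simp
  also have "\<dots> \<le> 1200 * (?B * (1 / sqrt (real Q) + real (t - u) ^ 2 / real N ^ d))"
    by (intro mult_left_mono) auto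
  finally show ?thesis by simp
next
  case True
  let ?B = "(24 * real d) ^ d" and ?p = "step_lists d n" and ?D = "real (t - u) ^ 2 / real N ^ d"
  define G where "G q xs = cut_window (list_walk d N b xs) u (v + q * a) (v + Suc q * a) t" for q xs
  define \<delta> where "\<delta> k = 3 * (?B * (6 / sqrt (real k) + ?D))" for k
  have B1: "1 \<le> ?B" using d by (intro one_le_power) auto
  have "16 * ?B \<le> sqrt (real a)" using a by (intro real_le_rsqrt)
  then have "0 < sqrt (real a)" using B1 by linarith
  then have a0: "a > 0" by simp
  have half: "1/2 \<le> measure_pmf.prob ?p {xs. G q xs}" if "q < Q" for q
  proof -
    have Qa: "Suc q * a \<le> Q * a" using that by (intro mult_le_mono1) auto
    have "measure_pmf.prob ?p {xs. \<not> G q xs} \<le> ?B * (4 / sqrt (real (v + Suc q * a - (v + q * a))) + ?D)"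
      unfolding G_def using d N t a0 Qa by (intro prob_not_cut_window_le) auto
    also have "\<dots> = 4 * ?B / sqrt (real a) + ?B * ?D" by (simp add: algebra_simps)
    also have "\<dots> \<le> 1/4 + 1/4"
      using True \<open>16 * ?B \<le> sqrt (real a)\<close> a0 by (intro add_mono) (auto simp: divide_le_eq)
    finally have "measure_pmf.prob ?p {xs. \<not> G q xs} \<le> 1/2" by simp
    moreover have "measure_pmf.prob ?p {xs. \<not> G q xs} = 1 - measure_pmf.prob ?p {xs. G q xs}"
      using measure_pmf.prob_compl[of "{xs. G q xs}" ?p] by (simp add: Collect_neg_eq Compl_eq_Diff_UNIV)
    ultimately show ?thesis by simp
  qed
  have "measure_pmf.prob ?p {xs. card {q. q < Q \<and> G q xs} \<le> r} \<le> 16 * (1 + 2 * (\<Sum>k\<in>{1..Q}. \<delta> k)) / real Q"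
  proof (rule prob_few_events_le)
    show "measure_pmf.prob ?p {xs. G q xs \<and> G q' xs}
      \<le> measure_pmf.prob ?p {xs. G q xs} * measure_pmf.prob ?p {xs. G q' xs} + \<delta> (q' - q)" if "q < q'" "q' < Q" for q q'
      unfolding G_def \<delta>_def by (rule prob_cut_window_pair_le) (use d N a0 that t in auto)
  qed (use d Q half in \<open>auto simp: \<delta>_def finite_step_lists\<close>)
  also have "(\<Sum>k\<in>{1..Q}. \<delta> k) = 3 * ?B * (6 * (\<Sum>k\<in>{1..Q}. 1 / sqrt (real k)) + real Q * ?D)"
    by (simp add: \<delta>_def sum_distrib_left[symmetric] sum.distrib sum_distrib_left)
  also have "\<dots> \<le> 3 * ?B * (6 * (2 * sqrt (real Q)) + real Q * ?D)"
    by (intro mult_left_mono add_right_mono sum_inverse_sqrt_le) auto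
  finally have "measure_pmf.prob ?p {xs. card {q. q < Q \<and> G q xs} \<le> r}
    \<le> 16 * (1 + 2 * (3 * ?B * (6 * (2 * sqrt (real Q)) + real Q * ?D))) / real Q"
    using Q by (simp add: divide_right_mono)
  also have "\<dots> = 16 * (1 / real Q) + 1152 * ?B * (sqrt (real Q) / real Q) + 96 * (?B * ?D)"
    using Q by (simp add: field_simps)
  also have "sqrt (real Q) / real Q = 1 / sqrt (real Q)" using Q by (simp add: field_simps)
  also have "1 / real Q \<le> ?B * (1 / sqrt (real Q))"
  proof -
    have "1 / real Q \<le> 1 / sqrt (real Q)" using Q
      by (intro divide_left_mono) (auto intro!: real_le_lsqrt self_le_power)
    also have "\<dots> \<le> ?B * (1 / sqrt (real Q))" using B1 mult_right_mono[OF B1, of "1 / sqrt (real Q)"] by simp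
    finally show ?thesis .
  qed
  also have "16 * (?B * (1 / sqrt (real Q))) + 1152 * ?B * (1 / sqrt (real Q)) + 96 * (?B * ?D)
    \<le> 1200 * (?B * (1 / sqrt (real Q))) + 1200 * (?B * ?D)"
  proof -
    have "0 \<le> ?B * (1 / sqrt (real Q))" "0 \<le> ?B * ?D" by simp_all
    then show ?thesis by linarith
  qed
  finally show ?thesis unfolding G_def by (simp add: algebra_simps)
qed

section \<open>Loop-erasures at fixed times and at the hitting time\<close>

lemma le_vertex_in_range: "le_vertex \<gamma> n i \<in> range \<gamma>"
  by (cases i) auto

lemma prob_hit_le_prefix_le:
  assumes d: "d \<ge> 5" and N: "N > 0" and t: "u + N^2 \<le> v" "v \<le> t" "t \<le> n"
  shows "measure_pmf.prob (step_lists d n) {xs. \<exists>y\<in>{v..t}. list_walk d N b xs y \<in> le_prefix (list_walk d N b xs) u r}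
    \<le> real (Suc (t - v)) * real r * ((24 * real d) ^ d / real N ^ d)"
proof -
  let ?p = "step_lists d n" and ?X = "list_walk d N b" and ?\<beta> = "(24 * real d) ^ d / real N ^ d"
  define g where "g i xs = le_vertex (\<lambda>j. ?X xs (min j u)) u i" for i xs
  have g: "g i xs \<in> torus d N" for i xs
    using le_vertex_in_range[of "\<lambda>j. ?X xs (min j u)" u i] list_walk_in_torus[OF N] by (auto simp: g_def)
  have past: "g i (take u xs) = g i xs" for i xs
    by (simp add: g_def list_walk_take)
  have one: "measure_pmf.prob ?p {xs. ?X xs y = g i xs} \<le> ?\<beta>" if y: "y \<in> {v..t}" for y i
  proof -
    have "walk_kernel d N (y - u) z \<le> ?\<beta>" for z
    proof -
      have "walk_kernel d N (y - u) z \<le> abs_fourier_mean d N (y - u)"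
        using d N by (intro walk_kernel_le_abs_fourier_mean) auto
      also have "\<dots> \<le> ?\<beta>" using d N t y by (intro abs_fourier_mean_le_equilibrium) auto
      finally show ?thesis .
    qed
    then have "measure_pmf.prob ?p {xs. ?X xs y = g i (take u xs)} \<le> ?\<beta>"
      using t y g by (intro prob_hit_past_determined) auto
    then show ?thesis by (simp add: past)
  qed
  have "{xs. \<exists>y\<in>{v..t}. ?X xs y \<in> le_prefix (?X xs) u r} = (\<Union>y\<in>{v..t}. \<Union>i\<in>{..<r}. {xs. ?X xs y = g i xs})"
    by (auto simp: le_prefix_def g_def)
  then have "measure_pmf.prob ?p {xs. \<exists>y\<in>{v..t}. ?X xs y \<in> le_prefix (?X xs) u r}
    = measure_pmf.prob ?p (\<Union>y\<in>{v..t}. \<Union>i\<in>{..<r}. {xs. ?X xs y = g i xs})" by (rule arg_cong)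
  also have "\<dots> \<le> (\<Sum>y\<in>{v..t}. measure_pmf.prob ?p (\<Union>i\<in>{..<r}. {xs. ?X xs y = g i xs}))"
    by (rule measure_pmf.finite_measure_subadditive_finite) auto
  also have "\<dots> \<le> (\<Sum>y\<in>{v..t}. \<Sum>i\<in>{..<r}. measure_pmf.prob ?p {xs. ?X xs y = g i xs})"
    by (rule sum_mono, rule measure_pmf.finite_measure_subadditive_finite) auto
  also have "\<dots> \<le> (\<Sum>y\<in>{v..t}. \<Sum>i\<in>{..<r}. ?\<beta>)" by (intro sum_mono one)
  also have "\<dots> = real (Suc (t - v)) * real r * ?\<beta>" using t by (simp add: Suc_diff_le)
  finally show ?thesis .
qed

text \<open>
  The alternative of \<open>short_loop_erasure_cases\<close> for \<open>Q\<close> windows of length \<open>a\<close>, preceded by a stretch of length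
  \<open>Q * a\<close> in which the walk equilibrates. Unlike the loop-erasure itself it visibly depends on the path up to \<open>t\<close>
  only.
\<close>

definition short_witness :: "(nat \<Rightarrow> 'a) \<Rightarrow> nat \<Rightarrow> nat \<Rightarrow> nat \<Rightarrow> nat \<Rightarrow> bool" where
  "short_witness \<gamma> a Q r t \<longleftrightarrow>
    (\<exists>y\<in>{t - Q * a..t}. \<gamma> y \<in> le_prefix \<gamma> (t - 2 * Q * a) r) \<or>
    card {q. q < Q \<and> cut_window \<gamma> (t - 2 * Q * a) (t - Q * a + q * a) (t - Q * a + Suc q * a) t} \<le> r"

lemma short_witnessI:
  assumes "2 * Q * a \<le> t" "card (set (loop_erasure \<gamma> t)) \<le> r"
  shows "short_witness \<gamma> a Q r t"
proof -
  have "t - 2 * Q * a \<le> t - Q * a" "t - Q * a + Q * a \<le> t" using assms(1) by linarith+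
  then show ?thesis unfolding short_witness_def using assms(2) by (rule short_loop_erasure_cases)
qed

lemma short_witness_cong:
  assumes "\<And>j. j \<le> t \<Longrightarrow> \<gamma> j = \<gamma>' j"
  shows "short_witness \<gamma> a Q r t \<longleftrightarrow> short_witness \<gamma>' a Q r t"
proof -
  have 1: "le_prefix \<gamma> (t - 2 * Q * a) r = le_prefix \<gamma>' (t - 2 * Q * a) r"
    unfolding le_prefix_def using assms by simp
  have 2: "cut_window \<gamma> u \<alpha> \<beta> t = cut_window \<gamma>' u \<alpha> \<beta> t" if "\<alpha> \<le> \<beta>" for u \<alpha> \<beta>
    unfolding cut_window_def using assms that by (intro ball_cong refl) auto
  have 3: "(\<exists>y\<in>{t - Q * a..t}. \<gamma> y \<in> A) \<longleftrightarrow> (\<exists>y\<in>{t - Q * a..t}. \<gamma>' y \<in> A)" for A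
    using assms by (intro bex_cong refl) simp
  show ?thesis unfolding short_witness_def 1 3 by (simp add: 2)
qed

lemma prob_short_witness_le:
  assumes d: "d \<ge> 5" and N: "N > 0" and a: "(16 * (24 * real d) ^ d)^2 \<le> real a"
    and Q: "N^2 \<le> Q" "real r \<le> real Q / 4" and t: "2 * Q * a \<le> t" "t \<le> n"
  shows "measure_pmf.prob (step_lists d n) {xs. short_witness (list_walk d N b xs) a Q r t}
    \<le> (24 * real d) ^ d * (1200 / sqrt (real Q) + 5000 * real a ^ 2 * (real Q ^ 2 / real N ^ d))"
proof -
  let ?B = "(24 * real d) ^ d" and ?p = "step_lists d n" and ?X = "list_walk d N b"
  let ?u = "t - 2 * Q * a" and ?v = "t - Q * a"
  have "1 \<le> ?B" using d by (intro one_le_power) auto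
  then have "1 \<le> 16 * ?B" by linarith
  then have "1 \<le> (16 * ?B)^2" by (rule one_le_power)
  then have a1: "1 \<le> a" using a by linarith
  have Q1: "1 \<le> Q" using Q(1) N by (metis One_nat_def Suc_leI le_trans power2_eq_square nat_0_less_mult_iff)
  have QQa: "Q \<le> Q * a" using a1 by simp
  have uv: "?u + N^2 \<le> ?v" using t(1) Q(1) QQa by linarith
  have P1: "measure_pmf.prob ?p {xs. \<exists>y\<in>{?v..t}. ?X xs y \<in> le_prefix (?X xs) ?u r}
    \<le> real (Suc (t - ?v)) * real r * (?B / real N ^ d)"
    using d N uv t by (intro prob_hit_le_prefix_le) auto
  have "real (Suc (t - ?v)) * real r \<le> (2 * (real Q * real a)) * (real Q * real a)"
  proof (intro mult_mono)
    have "Suc (t - ?v) \<le> 2 * (Q * a)" using t(1) Q1 QQa by linarith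
    then show "real (Suc (t - ?v)) \<le> 2 * (real Q * real a)" by (metis of_nat_le_iff of_nat_mult of_nat_numeral)
    have "real r \<le> real Q" using Q(2) by simp
    also have "real Q \<le> real Q * real a" using a1 by (simp add: mult_le_cancel_left1)
    finally show "real r \<le> real Q * real a" .
  qed auto
  then have "real (Suc (t - ?v)) * real r * (?B / real N ^ d) \<le> (2 * (real Q * real a)) * (real Q * real a) * (?B / real N ^ d)"
    by (rule mult_right_mono) simp
  also have "\<dots> = ?B * (2 * real a ^ 2 * (real Q ^ 2 / real N ^ d))" by (simp add: power2_eq_square)
  finally have P1': "measure_pmf.prob ?p {xs. \<exists>y\<in>{?v..t}. ?X xs y \<in> le_prefix (?X xs) ?u r}
    \<le> ?B * (2 * real a ^ 2 * (real Q ^ 2 / real N ^ d))" using P1 by linarith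
  have "measure_pmf.prob ?p {xs. card {q. q < Q \<and> cut_window (?X xs) ?u (?v + q * a) (?v + Suc q * a) t} \<le> r}
    \<le> 1200 * ?B * (1 / sqrt (real Q) + real (t - ?u) ^ 2 / real N ^ d)"
    using d N a Q Q1 t by (intro prob_few_cut_windows_le) auto
  also have "real (t - ?u) = 2 * real Q * real a" using t by simp
  also have "1200 * ?B * (1 / sqrt (real Q) + (2 * real Q * real a) ^ 2 / real N ^ d)
    = ?B * (1200 / sqrt (real Q) + 4800 * real a ^ 2 * (real Q ^ 2 / real N ^ d))"
    by (simp add: algebra_simps power_mult_distrib)
  finally have P2: "measure_pmf.prob ?p {xs. card {q. q < Q \<and> cut_window (?X xs) ?u (?v + q * a) (?v + Suc q * a) t} \<le> r}
    \<le> ?B * (1200 / sqrt (real Q) + 4800 * real a ^ 2 * (real Q ^ 2 / real N ^ d))" .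
  have "measure_pmf.prob ?p {xs. short_witness (?X xs) a Q r t}
    \<le> measure_pmf.prob ?p {xs. \<exists>y\<in>{?v..t}. ?X xs y \<in> le_prefix (?X xs) ?u r}
      + measure_pmf.prob ?p {xs. card {q. q < Q \<and> cut_window (?X xs) ?u (?v + q * a) (?v + Suc q * a) t} \<le> r}"
    unfolding short_witness_def Collect_disj_eq by (intro measure_Un_le) auto
  also have "\<dots> \<le> ?B * (2 * real a ^ 2 * (real Q ^ 2 / real N ^ d))
      + ?B * (1200 / sqrt (real Q) + 4800 * real a ^ 2 * (real Q ^ 2 / real N ^ d))"
    by (intro add_mono P1' P2)
  also have "\<dots> = ?B * (1200 / sqrt (real Q)) + 4802 * (?B * (real a ^ 2 * (real Q ^ 2 / real N ^ d)))"
    by (simp add: algebra_simps)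
  also have "\<dots> \<le> ?B * (1200 / sqrt (real Q)) + 5000 * (?B * (real a ^ 2 * (real Q ^ 2 / real N ^ d)))"
    by (intro add_left_mono mult_right_mono) auto
  also have "\<dots> = ?B * (1200 / sqrt (real Q) + 5000 * real a ^ 2 * (real Q ^ 2 / real N ^ d))"
    by (simp add: algebra_simps)
  finally show ?thesis .
qed

text \<open>
  Union bound over the hitting time. The events that the walk is at \<open>e\<close> at time \<open>t\<close> are disjoint for different \<open>e\<close>, so
  summing over \<open>e\<close> leaves the probability of a short loop-erasure at the fixed time \<open>t\<close>.
\<close>

lemma prob_short_at_target_le:
  assumes E: "{(e, \<omega>) \<in> space (target_and_steps d N).
      real (card (set (loop_erasure (torus_walk d N b \<omega>) (hitting_time (torus_walk d N b \<omega>) e)))) \<le> c}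
    \<in> sets (target_and_steps d N)" (is "?E \<in> _")
    and d: "d \<ge> 5" and N: "N > 0" and M: "M > 0" and c: "c < real (Suc r)"
    and K: "\<And>t. 2 * Q * a \<le> t \<Longrightarrow> t < M \<Longrightarrow>
      measure_pmf.prob (step_lists d M) {xs. short_witness (list_walk d N b xs) a Q r t} \<le> K" and "K \<ge> 0"
  shows "measure (target_and_steps d N) ?E
    \<le> 4 * green_bound d * real N ^ d / real M + (real (2 * Q * a) + real M * K) / real N ^ d"
proof -
  let ?S = "stream_space (measure_pmf (pmf_of_set (unit_steps d)))" and ?T = "torus d N" and ?p = "step_lists d M"
  let ?U = "measure_pmf (pmf_of_set ?T)" and ?X = "list_walk d N b"
  interpret S: prob_space ?S by (rule prob_space.prob_space_stream_space[OF measure_pmf.prob_space_axioms])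
  interpret P: prob_space "target_and_steps d N" by (rule prob_space_target_and_steps)
  have finU: "finite (set_pmf (pmf_of_set (unit_steps d)))"
    using finite_unit_steps[of d] unit_steps_nonempty[of d] d by simp
  define bad where "bad t xs \<longleftrightarrow> t < 2 * Q * a \<or> short_witness (?X xs) a Q r t" for t xs
  have sec: "Pair e -` ?E \<in> sets ?S" for e
    using sets_Pair1[OF E[unfolded target_and_steps_def]] unfolding target_and_steps_def .
  have "ennreal (P.prob ?E) = (\<integral>\<^sup>+e. emeasure ?S (Pair e -` ?E) \<partial>?U)"
    unfolding P.emeasure_eq_measure[symmetric]
    using S.emeasure_pair_measure_alt[OF E[unfolded target_and_steps_def]] unfolding target_and_steps_def .
  also have "\<dots> = (\<integral>\<^sup>+e. ennreal (S.prob (Pair e -` ?E)) \<partial>?U)" by (simp add: S.emeasure_eq_measure)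
  also have "\<dots> = ennreal (measure_pmf.expectation (pmf_of_set ?T) (\<lambda>e. S.prob (Pair e -` ?E)))"
    by (intro nn_integral_eq_integral measure_pmf.integrable_const_bound[of _ 1]) auto
  finally have "P.prob ?E = measure_pmf.expectation (pmf_of_set ?T) (\<lambda>e. S.prob (Pair e -` ?E))"
    by (simp add: integral_nonneg_AE)
  also have "\<dots> = (\<Sum>e\<in>?T. S.prob (Pair e -` ?E)) / real N ^ d"
    using N by (simp add: integral_pmf_of_set torus_nonempty finite_torus card_torus)
  also have "\<dots> \<le> (\<Sum>e\<in>?T. measure_pmf.prob ?p {xs. \<forall>t<M. ?X xs t \<noteq> e} + (\<Sum>t<M. measure_pmf.prob ?p {xs. ?X xs t = e \<and> bad t xs})) / real N ^ d"
  proof (intro divide_right_mono sum_mono)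
    fix e
    have "S.prob (Pair e -` ?E) \<le> measure_pmf.prob ?p {xs. (\<forall>t<M. ?X xs t \<noteq> e) \<or> (\<exists>t<M. ?X xs t = e \<and> bad t xs)}"
    proof (rule stream_prob_le_list_prob[OF sec finU])
      fix \<omega> assume "\<omega> \<in> Pair e -` ?E"
      then have short: "real (card (set (loop_erasure (torus_walk d N b \<omega>) (hitting_time (torus_walk d N b \<omega>) e)))) \<le> c"
        by simp
      let ?xs = "stake M \<omega>"
      have walk: "torus_walk d N b \<omega> j = ?X ?xs j" if "j \<le> M" for j
        by (rule torus_walk_eq_list_walk[OF that])
      show "(\<forall>t<M. ?X ?xs t \<noteq> e) \<or> (\<exists>t<M. ?X ?xs t = e \<and> bad t ?xs)"
      proof (rule disjCI)
        assume no: "\<not> (\<exists>t<M. ?X ?xs t = e \<and> bad t ?xs)"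
        show "\<forall>t<M. ?X ?xs t \<noteq> e"
        proof (rule ccontr)
          assume "\<not> ?thesis"
          then obtain s where s: "s < M" "torus_walk d N b \<omega> s = e" using walk by auto
          define t where "t = hitting_time (torus_walk d N b \<omega>) e"
          have t: "torus_walk d N b \<omega> t = e" "t \<le> s"
            unfolding t_def hitting_time_def using s(2) by (rule LeastI, rule Least_le)
          have "card (set (loop_erasure (torus_walk d N b \<omega>) t)) \<le> r"
            using short c unfolding t_def by linarith
          then have "2 * Q * a \<le> t \<Longrightarrow> short_witness (torus_walk d N b \<omega>) a Q r t" by (rule short_witnessI[rotated])
          moreover have "short_witness (torus_walk d N b \<omega>) a Q r t = short_witness (?X ?xs) a Q r t"
            using t s by (intro short_witness_cong walk) auto
          ultimately have "bad t ?xs" unfolding bad_def by linarith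
          then show False using no t s walk[of t] by auto
        qed
      qed
    qed
    also have "\<dots> \<le> measure_pmf.prob ?p {xs. \<forall>t<M. ?X xs t \<noteq> e} + measure_pmf.prob ?p (\<Union>t\<in>{..<M}. {xs. ?X xs t = e \<and> bad t xs})"
    proof -
      have "{xs. (\<forall>t<M. ?X xs t \<noteq> e) \<or> (\<exists>t<M. ?X xs t = e \<and> bad t xs)}
        = {xs. \<forall>t<M. ?X xs t \<noteq> e} \<union> (\<Union>t\<in>{..<M}. {xs. ?X xs t = e \<and> bad t xs})" by auto
      then show ?thesis by (simp only:) (intro measure_Un_le, auto)
    qed
    also have "\<dots> \<le> measure_pmf.prob ?p {xs. \<forall>t<M. ?X xs t \<noteq> e} + (\<Sum>t<M. measure_pmf.prob ?p {xs. ?X xs t = e \<and> bad t xs})"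
      by (intro add_left_mono measure_pmf.finite_measure_subadditive_finite) auto
    finally show "S.prob (Pair e -` ?E) \<le> \<dots>" .
  qed simp
  also have "\<dots> = (\<Sum>e\<in>?T. measure_pmf.prob ?p {xs. \<forall>t<M. ?X xs t \<noteq> e}) / real N ^ d
      + (\<Sum>t<M. \<Sum>e\<in>?T. measure_pmf.prob ?p {xs. ?X xs t = e \<and> bad t xs}) / real N ^ d"
    by (simp only: sum.distrib add_divide_distrib sum.swap[of _ "{..<M}" ?T])
  also have "\<dots> \<le> 4 * green_bound d * real N ^ d / real M + (real (2 * Q * a) + real M * K) / real N ^ d"
  proof (intro add_mono divide_right_mono mean_prob_not_hit_le d N M)
    have at: "(\<Sum>e\<in>?T. measure_pmf.prob ?p {xs. ?X xs t = e \<and> bad t xs}) = measure_pmf.prob ?p {xs. bad t xs}" for t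
    proof -
      have "measure_pmf.prob ?p (\<Union>e\<in>?T. {xs. ?X xs t = e \<and> bad t xs}) = (\<Sum>e\<in>?T. measure_pmf.prob ?p {xs. ?X xs t = e \<and> bad t xs})"
        by (intro measure_pmf.finite_measure_finite_Union finite_torus) (auto simp: disjoint_family_on_def)
      moreover have "(\<Union>e\<in>?T. {xs. ?X xs t = e \<and> bad t xs}) = {xs. bad t xs}"
        using list_walk_in_torus[OF N] by auto
      ultimately show ?thesis by simp
    qed
    have "(\<Sum>t<M. \<Sum>e\<in>?T. measure_pmf.prob ?p {xs. ?X xs t = e \<and> bad t xs}) \<le> (\<Sum>t<M. of_bool (t < 2 * Q * a) + K)"
      unfolding at
    proof (intro sum_mono)
      fix t assume t: "t \<in> {..<M}"
      show "measure_pmf.prob ?p {xs. bad t xs} \<le> of_bool (t < 2 * Q * a) + K"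
      proof (cases "t < 2 * Q * a")
        case True
        have "measure_pmf.prob ?p {xs. bad t xs} \<le> 1" by simp
        moreover have "of_bool (t < 2 * Q * a) = (1 :: real)" using True by simp
        ultimately show ?thesis using \<open>K \<ge> 0\<close> by linarith
      next
        case False
        then show ?thesis using K[of t] t by (simp add: bad_def)
      qed
    qed
    also have "\<dots> = real (card ({..<M} \<inter> {t. t < 2 * Q * a})) + real M * K"
      by (simp add: sum.distrib)
    also have "card ({..<M} \<inter> {t. t < 2 * Q * a}) \<le> card {..<2 * Q * a}" by (intro card_mono) auto
    finally show "(\<Sum>t<M. \<Sum>e\<in>?T. measure_pmf.prob ?p {xs. ?X xs t = e \<and> bad t xs}) \<le> real (2 * Q * a) + real M * K"
      by simp
  qed simp
  finally show ?thesis .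
qed

text \<open>
  With \<open>s = lam * N^(d/2)\<close>, both bounds come from \<open>lam * sqrt N \<ge> 1\<close>: the first after multiplication by \<open>N^2\<close>, the
  second from its fifth power, which gives \<open>lam^4 * s \<ge> 1\<close>.
\<close>

lemma short_scale_bounds:
  assumes d: "d \<ge> 5" and N: "N > 0" and lam: "real N powr (- 1 / 2) \<le> lam"
  shows "lam > 0" "real N ^ 2 \<le> lam * sqrt (real N ^ d)" "1 / sqrt (lam * sqrt (real N ^ d)) \<le> lam^2"
proof -
  have pw: "real N powr (- 1 / 2) = 1 / sqrt (real N)"
    using N by (simp add: powr_minus powr_half_sqrt inverse_eq_divide)
  show pos: "lam > 0" using lam N by (smt (verit) pw divide_pos_pos of_nat_0_less_iff real_sqrt_gt_zero)
  have one: "1 \<le> lam * sqrt (real N)" using lam N unfolding pw by (simp add: divide_le_eq mult.commute)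
  have root: "sqrt (real N) ^ 5 \<le> sqrt (real N ^ d)"
  proof -
    have "sqrt (real N) ^ 5 = sqrt (real N ^ 5)" by (simp add: real_sqrt_power)
    also have "\<dots> \<le> sqrt (real N ^ d)" using d N by (intro real_sqrt_le_mono power_increasing) auto
    finally show ?thesis .
  qed
  have N4: "real N ^ 2 = sqrt (real N) ^ 4"
  proof -
    have "x ^ 4 = (x^2)^2" for x :: real by (simp add: power4_eq_xxxx power2_eq_square)
    from this[of "sqrt (real N)"] show ?thesis by (simp only: real_sqrt_pow2 of_nat_0_le_iff)
  qed
  have "real N ^ 2 * 1 \<le> sqrt (real N) ^ 4 * (lam * sqrt (real N))"
    unfolding N4 using one by (intro mult_left_mono) auto
  also have "\<dots> = lam * sqrt (real N) ^ 5" by (simp add: eval_nat_numeral)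
  also have "\<dots> \<le> lam * sqrt (real N ^ d)" using root pos by (intro mult_left_mono) auto
  finally show "real N ^ 2 \<le> lam * sqrt (real N ^ d)" by simp
  let ?s = "lam * sqrt (real N ^ d)"
  have s0: "?s > 0" using pos N by simp
  have "1 \<le> (lam * sqrt (real N)) ^ 5" using one by (rule one_le_power)
  also have "\<dots> = lam ^ 5 * sqrt (real N) ^ 5" by (simp add: power_mult_distrib)
  also have "\<dots> \<le> lam ^ 5 * sqrt (real N ^ d)" using root pos by (intro mult_left_mono) auto
  also have "\<dots> = (lam^2 * sqrt ?s)^2" using s0 by (simp add: power_mult_distrib eval_nat_numeral)
  finally have "1^2 \<le> (lam^2 * sqrt ?s)^2" by simp
  then have "1 \<le> lam^2 * sqrt ?s" by (rule power2_le_imp_le) (use s0 in simp)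
  then show "1 / sqrt ?s \<le> lam^2" using s0 by (simp add: divide_le_eq)
qed

theorem theorem2:
  fixes d :: nat
  assumes "d \<ge> 5"
  shows "\<exists>C>0. \<forall>N>0. \<forall>b\<in>torus d N. \<forall>lam::real. lam \<ge> real N powr (- 1 / 2) \<longrightarrow>
    \<P>((e, \<omega>) in target_and_steps d N.
      real (card (set (loop_erasure (torus_walk d N b \<omega>) (hitting_time (torus_walk d N b \<omega>) e))))
        \<le> lam * real N powr (real d / 2))
    \<le> C * lam * capped_log (inverse lam)"
proof -
  define B where "B = (24 * real d) ^ d"
  \<comment> \<open>makes the windows so long that loops shorter than \<open>N^2\<close> cross one with probability at most 1/4\<close>
  define a where "a = nat \<lceil>(16 * B)^2\<rceil>"
  define K where "K = B * (1200 + 320000 * real a ^ 2)"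
  define C where "C = 4 * green_bound d + 16 * real a + 2 * K + 1"
  have B0: "B \<ge> 0" by (simp add: B_def)
  have G0: "green_bound d \<ge> 0" by (simp add: green_bound_def)
  have a: "(16 * B)^2 \<le> real a" by (simp add: a_def real_nat_ceiling_ge)
  have K0: "K \<ge> 0" using B0 by (simp add: K_def)
  have C1: "C \<ge> 1" using G0 K0 by (simp add: C_def)
  show ?thesis
  proof (intro exI[of _ C] conjI allI ballI impI)
    show "C > 0" using C1 by simp
    fix N b and lam :: real
    assume N: "N > 0" and "b \<in> torus d N" and lam: "real N powr (- 1 / 2) \<le> lam"
    define w where "w = sqrt (real N ^ d)"
    define s where "s = lam * w"
    note bounds = short_scale_bounds[OF assms N lam, folded w_def, folded s_def]
    have w: "w \<ge> 1" "w^2 = real N ^ d" using N by (auto simp: w_def intro!: one_le_power)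
    have pw: "real N powr (real d / 2) = w"
    proof -
      have "real N powr (real d / 2) = (real N powr real d) powr (1 / 2)" by (simp add: powr_powr)
      then show ?thesis using N by (simp add: powr_realpow powr_half_sqrt w_def)
    qed
    let ?E = "{(e, \<omega>) \<in> space (target_and_steps d N).
      real (card (set (loop_erasure (torus_walk d N b \<omega>) (hitting_time (torus_walk d N b \<omega>) e)))) \<le> s}"
    interpret P: prob_space "target_and_steps d N" by (rule prob_space_target_and_steps)
    have "P.prob ?E \<le> C * lam"
    proof (cases "lam \<ge> 1")
      case True
      have "P.prob ?E \<le> 1" by simp
      also have "1 \<le> C * lam" using C1 True mult_mono[of 1 C 1 lam] by simp
      finally show ?thesis .
    next
      case False
      define r where "r = nat \<lfloor>s\<rfloor>"
      \<comment> \<open>unless the asserted bound is trivial, at least half of the windows are cut on average, which is at least \<open>2 * r\<close>\<close>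
      define Q where "Q = 4 * nat \<lceil>s\<rceil>"
      \<comment> \<open>averaged over \<open>e\<close>, the walk misses \<open>e\<close> before time \<open>M\<close> with probability at most of order \<open>lam\<close>\<close>
      define M where "M = nat \<lceil>w^2 / lam\<rceil>"
      have N1: "1 \<le> real N ^ 2" using N by (intro one_le_power) auto
      then have s1: "1 \<le> s" using bounds(2) by linarith
      have nat_ceil: "x \<le> real (nat \<lceil>x\<rceil>) \<and> real (nat \<lceil>x\<rceil>) \<le> 2 * x" if "1 \<le> x" for x :: real
      proof -
        have "real (nat \<lceil>x\<rceil>) = real_of_int \<lceil>x\<rceil>" using that by simp
        moreover have "x \<le> real_of_int \<lceil>x\<rceil>" "real_of_int \<lceil>x\<rceil> < x + 1" by linarith+
        ultimately show ?thesis using that by linarith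
      qed
      have "real r = real_of_int \<lfloor>s\<rfloor>" using s1 by (simp add: r_def)
      moreover have "real_of_int \<lfloor>s\<rfloor> \<le> s" "s < real_of_int \<lfloor>s\<rfloor> + 1" by linarith+
      ultimately have r: "real r \<le> s" "s < real (Suc r)" unfolding of_nat_Suc by linarith+
      have "real Q = 4 * real (nat \<lceil>s\<rceil>)" unfolding Q_def of_nat_mult by simp
      then have Q: "4 * s \<le> real Q" "real Q \<le> 8 * s" using nat_ceil[OF s1] by linarith+
      have "1 \<le> w^2" using w by (intro one_le_power)
      then have wl: "1 \<le> w^2 / lam" using False bounds(1) by (simp add: le_divide_eq)
      then have M: "w^2 / lam \<le> real M" "real M \<le> 2 * (w^2 / lam)"
        using nat_ceil[OF wl] unfolding M_def by blast+
      have M0: "M > 0" using M(1) wl by (cases M) auto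
      have NQ: "N^2 \<le> Q"
      proof -
        have "real (N^2) \<le> real Q" using bounds(2) Q(1) s1 unfolding of_nat_power by linarith
        then show ?thesis by (simp only: of_nat_le_iff)
      qed
      have sw: "s^2 / w^2 = lam^2" using w(1) by (simp add: s_def power_mult_distrib)
      have KQ: "B * (1200 / sqrt (real Q) + 5000 * real a ^ 2 * (real Q ^ 2 / w^2)) \<le> K * lam^2"
      proof -
        have "1200 / sqrt (real Q) \<le> 1200 / sqrt s" using Q(1) s1 by (intro divide_left_mono) auto
        also have "\<dots> \<le> 1200 * lam^2" using bounds(3) by simp
        finally have 1: "1200 / sqrt (real Q) \<le> 1200 * lam^2" .
        have "real Q ^ 2 \<le> (8 * s)^2" using Q by (intro power_mono) auto
        then have "real Q ^ 2 / w^2 \<le> (8 * s)^2 / w^2" by (intro divide_right_mono) auto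
        also have "\<dots> = 64 * lam^2" using sw by (simp add: power_mult_distrib)
        finally have "5000 * real a ^ 2 * (real Q ^ 2 / w^2) \<le> 5000 * real a ^ 2 * (64 * lam^2)"
          by (intro mult_left_mono) auto
        with 1 have "1200 / sqrt (real Q) + 5000 * real a ^ 2 * (real Q ^ 2 / w^2) \<le> (1200 + 320000 * real a ^ 2) * lam^2"
          by (simp add: algebra_simps)
        from mult_left_mono[OF this B0] show ?thesis by (simp add: K_def mult.assoc)
      qed
      have "P.prob ?E \<le> 4 * green_bound d * real N ^ d / real M + (real (2 * Q * a) + real M * (K * lam^2)) / real N ^ d"
      proof (rule prob_short_at_target_le[OF sets_short_loop_erasure[OF N] assms N M0 r(2)])
        fix t assume t: "2 * Q * a \<le> t" "t < M"
        have "measure_pmf.prob (step_lists d M) {xs. short_witness (list_walk d N b xs) a Q r t}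
          \<le> (24 * real d) ^ d * (1200 / sqrt (real Q) + 5000 * real a ^ 2 * (real Q ^ 2 / real N ^ d))"
          using assms N a NQ t r Q by (intro prob_short_witness_le) (auto simp: B_def)
        then show "measure_pmf.prob (step_lists d M) {xs. short_witness (list_walk d N b xs) a Q r t} \<le> K * lam^2"
          using KQ unfolding B_def w(2) by linarith
      qed (use K0 in simp)
      also have "\<dots> = 4 * green_bound d * (w^2 / real M) + 2 * real a * (real Q / w^2) + K * (lam^2 * real M / w^2)"
        unfolding w(2)[symmetric] by (simp add: add_divide_distrib mult_ac)
      also have "\<dots> \<le> 4 * green_bound d * lam + 2 * real a * (8 * lam) + K * (2 * lam)"
      proof (intro add_mono mult_left_mono)
        show "w^2 / real M \<le> lam" using M M0 bounds(1) by (simp add: field_simps)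
        have "real Q / w^2 \<le> 8 * s / w^2" using Q by (intro divide_right_mono) auto
        also have "\<dots> = 8 * lam / w" using w(1) by (simp add: s_def power2_eq_square)
        also have "\<dots> \<le> 8 * lam / 1" using w(1) bounds(1) by (intro divide_left_mono) auto
        finally show "real Q / w^2 \<le> 8 * lam" by simp
        have "lam^2 * real M / w^2 \<le> lam^2 * (2 * (w^2 / lam)) / w^2"
          using M by (intro divide_right_mono mult_left_mono) auto
        also have "\<dots> = 2 * lam" using w(1) bounds(1) by (simp add: power2_eq_square)
        finally show "lam^2 * real M / w^2 \<le> 2 * lam" .
      qed (use G0 K0 in auto)
      also have "\<dots> \<le> C * lam" using bounds(1) by (simp add: C_def algebra_simps)
      finally show ?thesis .
    qed
    also have "C * lam * 1 \<le> C * lam * capped_log (inverse lam)"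
      using C1 bounds(1) by (intro mult_left_mono) (auto simp: capped_log_def)
    finally have "P.prob ?E \<le> C * lam * capped_log (inverse lam)" by simp
    then show "\<P>((e, \<omega>) in target_and_steps d N.
      real (card (set (loop_erasure (torus_walk d N b \<omega>) (hitting_time (torus_walk d N b \<omega>) e))))
        \<le> lam * real N powr (real d / 2))
      \<le> C * lam * capped_log (inverse lam)"
      unfolding pw s_def .
  qed
qed

end
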